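(* Let $d\ge 1$. For every $\epsilon\in(0,2]$ and every integer $r\ge 0$ there exists $R_0=R_0(\epsilon,r)\ge 1$ such that for all integers $R\ge R_0$, with $$K=K(R,\epsilon/2):=\frac{\log|E_R|}{\delta(R,\epsilon/2)},$$ and with invasion percolation (IP) and first passage percolation (FPP) coupled through the same edge weights, one has $$\mathbb{P}\big[\text{IP contains }(K,R)\text{ log-uniform FPP on }B_R\big]\ge 1-\epsilon$$ and $$\mathbb{P}\big[(K,R)\text{ log-uniform FPP contains IP on }B_r\big]\ge 1-\epsilon .$$ Moreover $K(R,\epsilon/2)=O(\epsilon^{-1}R^{4d}\log R)$ as $R\to\infty$, $\epsilon\to0^+$ (i.e. there are constants $C,R_1,\epsilon_1>0$ depending only on $d$ with $K(R,\epsilon/2)\le C\epsilon^{-1}R^{4d}\log R$ for all $R\ge R_1$ and $0<\epsilon\le\epsilon_1$).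
   Context: Lattice: $\mathbb{Z}^d$ with nearest-neighbor edge set $E$, origin $0$, and graph distance $d(\cdot,\cdot)$. For $R\in\mathbb{N}$, $B_R=\{v\in\mathbb{Z}^d:d(0,v)\le R\}$, $E_R$ is the set of edges between vertices of $B_R$, and $\partial B_R$ is the set of vertices at distance exactly $R$ from $0$. Probability space: i.i.d. weights $w(e)$, $e\in E$, uniform on $[0,1]$, with product measure $\mathbb{P}$. Almost surely all weights are distinct, and only such configurations are considered. Invasion percolation (IP): start with the vertex $0$ invaded. At each step, invade the edge of smallest weight among all non-invaded edges incident to at least one already invaded vertex, together with both of its endpoints. A vertex is called invaded if it is invaded at some (finite) step. First passage percolation (FPP), coupled to IP: for $K>0$ set $\tau_{K,e}=e^{K w(e)}$ (here the base $e$ is Euler's number), $T_K(\gamma)=\sum_{e\in\gamma}\tau_{K,e}$ for a path $\gamma$, $T_K(x,y)=\inf_\gamma T_K(\gamma)$ over paths $\gamma$ from $x$ to $y$ in $\mathbb{Z}^d$, and $T_K(0,\partial B_R)=\min_{v\in\partial B_R}T_K(0,v)$. Containment: for a set of vertices $V$, "IP contains $(K,R)$ log-uniform FPP on $V$" is the event that every $v\in V$ with $T_K(0,v)<T_K(0,\partial B_R)$ is invaded. "$(K,R)$ log-uniform FPP contains IP on $V$" is the event that every invaded $v\in V$ satisfies $T_K(0,v)<T_K(0,\partial B_R)$. For $R\ge1$ and $\epsilon\in(0,1]$, $$\delta(R,\epsilon)=\frac{1-(1-\epsilon)^{1/|E_R|}}{|E_R|-1}.$$ *)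

theory Defs
  imports "HOL-Probability.Probability"
begin

text \<open>The lattice \<open>\<int>\<^sup>d\<close> is the type \<open>int ^ 'd\<close>, with \<open>d = CARD('d) \<ge> 1\<close>.
  Edges are unordered pairs of vertices, i.e. two-element sets.\<close>

definition adjacent :: "int ^ 'd::finite \<Rightarrow> int ^ 'd \<Rightarrow> bool" where
  "adjacent x y \<longleftrightarrow> (\<Sum>i\<in>UNIV. \<bar>x $ i - y $ i\<bar>) = 1"

definition lattice_edges :: "(int ^ 'd::finite) set set" where
  "lattice_edges = {{x, y} | x y. adjacent x y}"

text \<open>Paths are finite vertex sequences which may repeat vertices; the one-vertex list is the
  path of length 0.\<close>

definition lattice_paths :: "int ^ 'd::finite \<Rightarrow> int ^ 'd \<Rightarrow> (int ^ 'd) list set" where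
  "lattice_paths x y = {p. p \<noteq> [] \<and> hd p = x \<and> last p = y \<and> successively adjacent p}"

definition path_edges :: "(int ^ 'd::finite) list \<Rightarrow> (int ^ 'd) set list" where
  "path_edges p = map2 (\<lambda>u v. {u, v}) p (tl p)"

definition graph_dist :: "int ^ 'd::finite \<Rightarrow> int ^ 'd \<Rightarrow> nat" where
  "graph_dist x y = (INF p\<in>lattice_paths x y. length (path_edges p))"

definition graph_ball :: "nat \<Rightarrow> (int ^ 'd::finite) set" where
  "graph_ball R = {v. graph_dist 0 v \<le> R}"

definition graph_sphere :: "nat \<Rightarrow> (int ^ 'd::finite) set" where
  "graph_sphere R = {v. graph_dist 0 v = R}"

definition ball_edges :: "nat \<Rightarrow> (int ^ 'd::finite) set set" where
  "ball_edges R = {e \<in> lattice_edges. e \<subseteq> graph_ball R}"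

definition weight_measure :: "((int ^ 'd::finite) set \<Rightarrow> real) measure" where
  "weight_measure = PiM lattice_edges (\<lambda>_. uniform_measure lborel {0..1})"


subsection \<open>Invasion percolation\<close>

definition touched_vertices :: "(int ^ 'd::finite) set set \<Rightarrow> (int ^ 'd) set" where
  "touched_vertices I = insert 0 (\<Union>I)"

definition frontier_edges :: "(int ^ 'd::finite) set set \<Rightarrow> (int ^ 'd) set set" where
  "frontier_edges I = {e \<in> lattice_edges. e \<notin> I \<and> e \<inter> touched_vertices I \<noteq> {}}"

text \<open>The frontier is always finite and nonempty, so the minimiser exists; it is unique when the
  weights are distinct, the only case in which the following is used.\<close>

primrec invaded_edges :: "((int ^ 'd::finite) set \<Rightarrow> real) \<Rightarrow> nat \<Rightarrow> (int ^ 'd) set set" where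
  "invaded_edges w 0 = {}"
| "invaded_edges w (Suc n) =
     insert (arg_min_on w (frontier_edges (invaded_edges w n))) (invaded_edges w n)"

definition invaded :: "((int ^ 'd::finite) set \<Rightarrow> real) \<Rightarrow> int ^ 'd \<Rightarrow> bool" where
  "invaded w v \<longleftrightarrow> (\<exists>n. v \<in> touched_vertices (invaded_edges w n))"


subsection \<open>Log-uniform first passage percolation\<close>

definition path_time :: "real \<Rightarrow> ((int ^ 'd::finite) set \<Rightarrow> real) \<Rightarrow> (int ^ 'd) list \<Rightarrow> real" where
  "path_time K w p = (\<Sum>e\<leftarrow>path_edges p. exp (K * w e))"

definition passage_time ::
  "real \<Rightarrow> ((int ^ 'd::finite) set \<Rightarrow> real) \<Rightarrow> int ^ 'd \<Rightarrow> int ^ 'd \<Rightarrow> real" where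
  "passage_time K w x y = (INF p\<in>lattice_paths x y. path_time K w p)"

definition exit_time :: "real \<Rightarrow> ((int ^ 'd::finite) set \<Rightarrow> real) \<Rightarrow> nat \<Rightarrow> real" where
  "exit_time K w R = (MIN v\<in>graph_sphere R. passage_time K w 0 v)"

definition IP_contains_FPP ::
  "real \<Rightarrow> nat \<Rightarrow> (int ^ 'd::finite) set \<Rightarrow> ((int ^ 'd) set \<Rightarrow> real) \<Rightarrow> bool" where
  "IP_contains_FPP K R V w \<longleftrightarrow>
     (\<forall>v\<in>V. passage_time K w 0 v < exit_time K w R \<longrightarrow> invaded w v)"

definition FPP_contains_IP ::
  "real \<Rightarrow> nat \<Rightarrow> (int ^ 'd::finite) set \<Rightarrow> ((int ^ 'd) set \<Rightarrow> real) \<Rightarrow> bool" where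
  "FPP_contains_IP K R V w \<longleftrightarrow>
     (\<forall>v\<in>V. invaded w v \<longrightarrow> passage_time K w 0 v < exit_time K w R)"


subsection \<open>The parameters\<close>

definition num_edges :: "'d::finite itself \<Rightarrow> nat \<Rightarrow> nat" where
  "num_edges _ R = card (ball_edges R :: (int ^ 'd) set set)"

definition delta :: "'d::finite itself \<Rightarrow> nat \<Rightarrow> real \<Rightarrow> real" where
  "delta d R \<epsilon> = (1 - (1 - \<epsilon>) powr (1 / real (num_edges d R))) / (real (num_edges d R) - 1)"

definition K_param :: "'d::finite itself \<Rightarrow> nat \<Rightarrow> real \<Rightarrow> real" where
  "K_param d R \<epsilon> = ln (real (num_edges d R)) / delta d R \<epsilon>"

end

theory Submission
  imports Defs
begin

text \<open>Fix \<open>t = \<epsilon> / 2\<close>, \<open>N = |E\<^sub>R|\<close> and \<open>\<delta> = \<delta>(R, t)\<close>. By a union bound over ordered pairs of edges, outside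
  an event of probability at most \<open>N (N - 1) \<delta> \<le> - ln (1 - t) < \<epsilon>\<close> (for \<open>\<epsilon> < 1\<close>) any two weights in \<open>E\<^sub>R\<close>
  differ by more than \<open>\<delta>\<close>; since \<open>exp (K \<delta>) = N\<close>, the passage time of an edge then exceeds the
  total passage time of all lighter edges of \<open>E\<^sub>R\<close>.

  The only fact needed about invasion percolation is that, when \<open>z\<close> is the most recently invaded
  vertex, any invaded vertex incident to a frontier edge \<open>f\<close> is linked to \<open>z\<close> by invaded edges
  lighter than \<open>f\<close>. So if a path from \<open>0\<close> leaves the invaded set through \<open>f\<close>, replacing \<open>f\<close> and
  everything after it by such a link gives a faster path to \<open>z\<close>. Taking \<open>z\<close> to be the first invaded
  vertex on the sphere gives the first containment. Taking \<open>z\<close> to be an invaded vertex of \<open>B\<^sub>r\<close>,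
  invaded before the sphere is reached, gives the second; with probability close to 1 a fixed number
  of steps (independent of \<open>R\<close>) suffices to invade every vertex of \<open>B\<^sub>r\<close> that is ever invaded.\<close>

subsection \<open>Paths and distances in the lattice\<close>

text \<open>A closed form of \<open>graph_dist 0\<close>, as shown in
  \<open>graph_dist_eq_l1_norm\<close>. It turns questions about balls and spheres into ones about
  coordinates.\<close>

definition l1_norm :: "int ^ 'd::finite \<Rightarrow> nat" where
  "l1_norm x = (\<Sum>i\<in>UNIV. nat \<bar>x $ i\<bar>)"

lemma int_l1_norm: "int (l1_norm x) = (\<Sum>i\<in>UNIV. \<bar>x $ i\<bar>)"
  by (simp add: l1_norm_def)

lemma l1_norm_zero [simp]: "l1_norm 0 = 0"
  by (simp add: l1_norm_def)

lemma component_le_l1_norm: "\<bar>x $ i\<bar> \<le> int (l1_norm x)"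
  unfolding int_l1_norm by (rule member_le_sum) auto

lemma l1_norm_eq_zeroD: "l1_norm x = 0 \<Longrightarrow> x = 0"
  by (auto simp: l1_norm_def vec_eq_iff)

lemma adjacent_sym: "adjacent x y \<longleftrightarrow> adjacent y x"
  by (simp add: adjacent_def abs_minus_commute)

lemma l1_norm_adjacent_le:
  assumes "adjacent x y"
  shows "l1_norm y \<le> Suc (l1_norm x)"
proof -
  have "int (l1_norm y) \<le> (\<Sum>i\<in>UNIV. \<bar>x $ i\<bar> + \<bar>x $ i - y $ i\<bar>)"
    unfolding int_l1_norm by (rule sum_mono) auto
  also have "\<dots> = int (l1_norm x) + 1"
    using assms by (simp add: sum.distrib int_l1_norm adjacent_def)
  finally show ?thesis by linarith
qed

lemma doubleton_in_lattice_edges [simp]: "{x, y} \<in> lattice_edges \<longleftrightarrow> adjacent x y"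
  by (auto simp: lattice_edges_def doubleton_eq_iff adjacent_sym)

lemma lattice_edgeE:
  assumes "e \<in> lattice_edges" "x \<in> e"
  obtains y where "e = {x, y}" "adjacent x y"
proof -
  from assms obtain a b where "e = {a, b}" "adjacent a b" by (auto simp: lattice_edges_def)
  then show thesis using assms(2) that[of a] that[of b] adjacent_sym[of a b] by auto
qed

lemma path_edges_simps [simp]:
  "path_edges [x] = []"
  "path_edges (x # y # p) = {x, y} # path_edges (y # p)"
  by (simp_all add: path_edges_def)

lemma length_path_edges: "length (path_edges p) = length p - 1"
  by (simp add: path_edges_def)

lemma path_edges_append:
  "path_edges (p @ x # q) = path_edges (p @ [x]) @ path_edges (x # q)"
proof (induction p)
  case (Cons a p)
  then show ?case by (cases p) auto
qed simp

lemma path_edges_subset_lattice_edges: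
  "successively adjacent p \<Longrightarrow> set (path_edges p) \<subseteq> lattice_edges"
proof (induction p)
  case (Cons a p)
  then show ?case by (cases p) (auto simp: path_edges_def)
qed (simp add: path_edges_def)

lemma path_edges_vertices: "e \<in> set (path_edges p) \<Longrightarrow> e \<subseteq> set p"
proof (induction p)
  case (Cons a p)
  then show ?case by (cases p) (auto simp: path_edges_def)
qed (simp add: path_edges_def)

text \<open>The first edge contains the first vertex, which no later edge can contain. This lets the
  time of a simple path be bounded by a sum over a set of edges.\<close>

lemma distinct_path_edges: "distinct p \<Longrightarrow> distinct (path_edges p)"
proof (induction p)
  case (Cons a p)
  then show ?case by (cases p) (use path_edges_vertices in \<open>fastforce+\<close>)
qed (simp add: path_edges_def)

lemma lattice_paths_append:
  assumes "p @ [x] \<in> lattice_paths u x" "x # q \<in> lattice_paths x v"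
  shows "p @ x # q \<in> lattice_paths u v"
  using assms by (auto simp: lattice_paths_def successively_append_iff hd_append split: if_splits)

lemma lattice_paths_Cons:
  assumes "adjacent x y" "p \<in> lattice_paths y z"
  shows "x # p \<in> lattice_paths x z"
  using assms by (cases p) (auto simp: lattice_paths_def)

lemma l1_norm_le_path_length:
  assumes "p \<in> lattice_paths x y"
  shows "l1_norm y \<le> l1_norm x + length (path_edges p)"
  using assms
proof (induction p arbitrary: x)
  case Nil
  then show ?case by (simp add: lattice_paths_def)
next
  case (Cons a p)
  show ?case
  proof (cases p)
    case Nil
    then show ?thesis using Cons.prems by (auto simp: lattice_paths_def)
  next
    case (Cons b q)
    then have "p \<in> lattice_paths b y" "adjacent a b" "a = x"
      using Cons.prems by (auto simp: lattice_paths_def)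
    then show ?thesis
      using Cons.IH[of b] l1_norm_adjacent_le[of a b] Cons by simp
  qed
qed

lemma exists_shortest_path: "\<exists>p\<in>lattice_paths 0 v. length (path_edges p) = l1_norm v"
proof (induction "l1_norm v" arbitrary: v)
  case 0
  then have "v = 0" using l1_norm_eq_zeroD by metis
  then show ?case by (intro bexI[of _ "[0]"]) (auto simp: lattice_paths_def)
next
  case (Suc n)
  have "v \<noteq> 0" using Suc.hyps(2) by auto
  then obtain i where i: "v $ i \<noteq> 0" by (auto simp: vec_eq_iff)
  \<comment> \<open>Moving one nonzero coordinate a unit towards 0 gives a neighbour of norm exactly
    one less, to which the induction applies.\<close>
  define u where "u = (\<chi> j. if j = i then v $ i - sgn (v $ i) else v $ j)"
  have adj: "adjacent u v"
  proof -
    have "(\<Sum>j\<in>UNIV. \<bar>u $ j - v $ j\<bar>) = (\<Sum>j\<in>UNIV. if j = i then 1 else 0)"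
      using i by (intro sum.cong) (auto simp: u_def)
    then show ?thesis by (simp add: adjacent_def)
  qed
  have "int (l1_norm v) = (\<Sum>j\<in>UNIV. \<bar>u $ j\<bar> + (if j = i then 1 else 0))"
    unfolding int_l1_norm using i by (intro sum.cong) (auto simp: u_def sgn_if)
  also have "\<dots> = int (l1_norm u) + 1"
    by (simp add: sum.distrib int_l1_norm)
  finally have "n = l1_norm u" using Suc.hyps(2) by linarith
  from Suc.hyps(1)[OF this] obtain p where p: "p \<in> lattice_paths 0 u" "length (path_edges p) = l1_norm u"
    by blast
  have "p @ [v] \<in> lattice_paths 0 v"
    using p(1) adj by (auto simp: lattice_paths_def successively_append_iff)
  moreover have "length (path_edges (p @ [v])) = l1_norm v"
    using p \<open>n = l1_norm u\<close> Suc.hyps(2) by (cases p) (auto simp: length_path_edges lattice_paths_def)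
  ultimately show ?case by blast
qed

lemma lattice_paths_nonempty: "lattice_paths 0 v \<noteq> {}"
  using exists_shortest_path[of v] by blast

lemma graph_dist_eq_l1_norm: "graph_dist 0 v = l1_norm v"
  unfolding graph_dist_def
proof (rule antisym)
  obtain p where p: "p \<in> lattice_paths 0 v" "length (path_edges p) = l1_norm v"
    using exists_shortest_path by blast
  show "(INF p\<in>lattice_paths 0 v. length (path_edges p)) \<le> l1_norm v"
    using cINF_lower[OF _ p(1), of "\<lambda>p. length (path_edges p)"] p(2) by simp
  show "l1_norm v \<le> (INF p\<in>lattice_paths 0 v. length (path_edges p))"
    using l1_norm_le_path_length[of _ 0 v]
    by (intro cINF_greatest lattice_paths_nonempty) auto
qed

lemma mem_graph_ball: "v \<in> graph_ball R \<longleftrightarrow> l1_norm v \<le> R"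
  and mem_graph_sphere: "v \<in> graph_sphere R \<longleftrightarrow> l1_norm v = R"
  by (simp_all add: graph_ball_def graph_sphere_def graph_dist_eq_l1_norm)

section \<open>Sizes of balls, spheres and their edge sets\<close>

lemma card_graph_ball_le:
  "finite (graph_ball R :: (int ^ 'd::finite) set)"
  "card (graph_ball R :: (int ^ 'd) set) \<le> (2 * R + 1) ^ CARD('d)"
proof -
  let ?P = "Pi\<^sub>E UNIV (\<lambda>_::'d. {- int R..int R})"
  have fin: "finite ?P" by (intro finite_PiE) auto
  have inj: "inj_on (\<lambda>v i. v $ i) (graph_ball R :: (int ^ 'd) set)"
    by (auto simp: inj_on_def vec_eq_iff fun_eq_iff)
  have "\<bar>v $ i\<bar> \<le> int R" if "v \<in> graph_ball R" for v :: "int ^ 'd" and i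
    using component_le_l1_norm[of v i] that by (auto simp: mem_graph_ball)
  then have sub: "(\<lambda>v i. v $ i) ` (graph_ball R :: (int ^ 'd) set) \<subseteq> ?P"
    by (auto simp: abs_le_iff) (metis minus_le_iff)
  show "finite (graph_ball R :: (int ^ 'd) set)"
    by (rule inj_on_finite[OF inj sub fin])
  have "card (graph_ball R :: (int ^ 'd) set) \<le> card ?P"
    by (rule card_inj_on_le[OF inj sub fin])
  also have "\<dots> = (2 * R + 1) ^ CARD('d)"
    by (simp add: card_PiE nat_add_distrib nat_mult_distrib)
  finally show "card (graph_ball R :: (int ^ 'd) set) \<le> (2 * R + 1) ^ CARD('d)" .
qed

lemma graph_sphere_subset_ball: "graph_sphere R \<subseteq> graph_ball R"
  by (auto simp: mem_graph_ball mem_graph_sphere)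

lemma finite_graph_sphere: "finite (graph_sphere R)"
  using graph_sphere_subset_ball card_graph_ball_le(1) by (rule finite_subset)

lemma graph_sphere_nonempty: "(graph_sphere R :: (int ^ 'd::finite) set) \<noteq> {}"
proof -
  fix i :: 'd
  have "l1_norm (axis i (int R)) = (\<Sum>j\<in>UNIV. if j = i then R else 0)"
    unfolding l1_norm_def by (intro sum.cong) (auto simp: axis_def)
  then have "axis i (int R) \<in> graph_sphere R"
    by (simp add: mem_graph_sphere)
  then show ?thesis by blast
qed

lemma finite_ball_edges: "finite (ball_edges R)"
  by (rule finite_subset[of _ "Pow (graph_ball R)"])
    (auto simp: ball_edges_def card_graph_ball_le(1))

text \<open>Every edge comes from an ordered pair of ball vertices. This crude count doubles the
  exponent \<open>CARD('d)\<close> of the vertex bound; as \<open>K_param\<close> grows like the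
  squared number of edges times its logarithm, it suffices for the exponent
  \<open>4 * CARD('d)\<close>.\<close>

lemma card_ball_edges_le:
  "card (ball_edges R :: (int ^ 'd::finite) set set) \<le> (2 * R + 1) ^ (2 * CARD('d))"
proof -
  let ?B = "graph_ball R :: (int ^ 'd) set"
  have "(ball_edges R :: (int ^ 'd) set set) \<subseteq> (\<lambda>(x, y). {x, y}) ` (?B \<times> ?B)"
    by (auto simp: ball_edges_def lattice_edges_def)
  then have "card (ball_edges R :: (int ^ 'd) set set) \<le> card (?B \<times> ?B)"
    by (intro surj_card_le) (auto simp: card_graph_ball_le(1))
  also have "\<dots> = card ?B ^ 2" by (simp add: card_cartesian_product power2_eq_square)
  also have "\<dots> \<le> ((2 * R + 1) ^ CARD('d)) ^ 2"
    by (intro power_mono card_graph_ball_le) auto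
  finally show ?thesis by (simp add: power_mult[symmetric] mult.commute)
qed

text \<open>The two edges at the origin along a single axis suffice, also in dimension 1. Hence the
  denominator of \<open>delta\<close> and the logarithm in \<open>K_param\<close> are
  positive.\<close>

lemma card_ball_edges_ge_2:
  assumes "R \<ge> 1"
  shows "card (ball_edges R :: (int ^ 'd::finite) set set) \<ge> 2"
proof -
  fix i :: 'd
  let ?a = "axis i 1 :: int ^ 'd" and ?b = "axis i (-1) :: int ^ 'd"
  have *: "(\<Sum>j\<in>UNIV. \<bar>axis i c $ j\<bar>) = \<bar>c\<bar>" for c :: int
  proof -
    have "(\<Sum>j\<in>UNIV. \<bar>axis i c $ j\<bar>) = (\<Sum>j\<in>UNIV. if j = i then \<bar>c\<bar> else 0)"
      by (intro sum.cong) (auto simp: axis_def)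
    then show ?thesis by simp
  qed
  have "adjacent 0 ?a" "adjacent 0 ?b"
    using *[of 1] *[of "-1"] by (simp_all add: adjacent_def)
  moreover have "l1_norm ?a = 1" "l1_norm ?b = 1"
    using *[of 1] *[of "-1"] int_l1_norm[of ?a] int_l1_norm[of ?b] by linarith+
  ultimately have sub: "{{0, ?a}, {0, ?b}} \<subseteq> ball_edges R"
    using assms by (auto simp: ball_edges_def mem_graph_ball)
  have "?a \<noteq> ?b" by (auto simp: vec_eq_iff axis_def)
  then have "card {{0, ?a}, {0, ?b}} = 2" by (auto simp: card_2_iff doubleton_eq_iff)
  then show ?thesis using card_mono[OF finite_ball_edges sub] by simp
qed

lemma path_crossing:
  assumes "successively adjacent p" "p \<noteq> []" "hd p \<in> V" "last p \<notin> V"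
  shows "\<exists>q x y q'. p = q @ x # y # q' \<and> x \<in> V \<and> y \<notin> V"
  using assms
proof (induction p)
  case (Cons a p)
  then obtain b s where p: "p = b # s" by (cases p) auto
  show ?case
  proof (cases "b \<in> V")
    case True
    then obtain q x y q' where "p = q @ x # y # q'" "x \<in> V" "y \<notin> V"
      using Cons p by auto
    then show ?thesis by (metis append_Cons)
  next
    case False
    then show ?thesis using Cons.prems p by (metis append_Nil list.sel(1))
  qed
qed simp

section \<open>Connections through a given set of edges\<close>

definition linked :: "(int ^ 'd::finite) set set \<Rightarrow> (int ^ 'd) rel" where
  "linked A = {(x, y). {x, y} \<in> A}\<^sup>*"

lemma linked_refl [simp]: "(x, x) \<in> linked A"
  by (simp add: linked_def)

lemma linked_sym: "(x, y) \<in> linked A \<Longrightarrow> (y, x) \<in> linked A"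
  unfolding linked_def by (rule symD[OF sym_rtrancl]) (auto simp: sym_def insert_commute)

lemma linked_trans: "(x, y) \<in> linked A \<Longrightarrow> (y, z) \<in> linked A \<Longrightarrow> (x, z) \<in> linked A"
  unfolding linked_def by (rule rtrancl_trans)

lemma linked_edge: "{x, y} \<in> A \<Longrightarrow> (x, y) \<in> linked A"
  by (auto simp: linked_def)

lemma linked_mono: "A \<subseteq> B \<Longrightarrow> linked A \<subseteq> linked B"
  unfolding linked_def by (intro rtrancl_mono) auto

text \<open>Distinct vertices are asked for so that each edge of \<open>A\<close> is paid for at
  most once when the path is timed.\<close>

lemma linked_imp_distinct_path:
  assumes "(x, z) \<in> linked A" "A \<subseteq> lattice_edges"
  obtains p where "p \<in> lattice_paths x z" "distinct p" "set (path_edges p) \<subseteq> A"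
proof -
  have "\<exists>p\<in>lattice_paths x z. distinct p \<and> set (path_edges p) \<subseteq> A"
    using assms(1) unfolding linked_def
  proof (induction rule: converse_rtrancl_induct)
    case base
    then show ?case by (intro bexI[of _ "[z]"]) (auto simp: lattice_paths_def)
  next
    case (step x y)
    then obtain p where p: "p \<in> lattice_paths y z" "distinct p" "set (path_edges p) \<subseteq> A" by blast
    have xy: "{x, y} \<in> A" "adjacent x y" using step assms(2) by auto
    show ?case
    proof (cases "x \<in> set p")
      case True
      \<comment> \<open>Prepending \<open>x\<close> would close a loop, so only the suffix from the
        earlier visit to \<open>x\<close> is kept.\<close>
      then obtain q q' where q: "p = q @ x # q'" by (auto simp: in_set_conv_decomp)
      then have "x # q' \<in> lattice_paths x z" "distinct (x # q')"
        using p by (auto simp: lattice_paths_def successively_append_iff)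
      moreover have "set (path_edges (x # q')) \<subseteq> A"
        using p(3) path_edges_append[of q x q'] q by auto
      ultimately show ?thesis by blast
    next
      case False
      moreover have "x # p \<in> lattice_paths x z" using xy p by (intro lattice_paths_Cons)
      moreover have "set (path_edges (x # p)) \<subseteq> A"
        using p xy by (cases p) (auto simp: lattice_paths_def)
      ultimately show ?thesis using p by (intro bexI[of _ "x # p"]) auto
    qed
  qed
  then show thesis using that by blast
qed

subsection \<open>Invasion percolation\<close>

lemma touched_vertices_subset_ball:
  "I \<subseteq> ball_edges n \<Longrightarrow> touched_vertices I \<subseteq> graph_ball n"
  by (auto simp: touched_vertices_def ball_edges_def mem_graph_ball)

lemma frontier_edges_subset_ball:
  assumes "touched_vertices I \<subseteq> graph_ball n"
  shows "frontier_edges I \<subseteq> ball_edges (Suc n)"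
proof
  fix e assume "e \<in> frontier_edges I"
  then obtain x where x: "e \<in> lattice_edges" "x \<in> e" "x \<in> touched_vertices I"
    by (auto simp: frontier_edges_def)
  then obtain y where "e = {x, y}" "adjacent x y" by (blast elim: lattice_edgeE)
  then show "e \<in> ball_edges (Suc n)"
    using x assms l1_norm_adjacent_le[of x y] by (auto simp: ball_edges_def mem_graph_ball)
qed

text \<open>The edge by which the path leaves the touched set has an untouched endpoint, so it is
  not in \<open>I\<close> and lies on the frontier. The prefix ending at \<open>x\<close> is kept as
  a path to which a detour can be attached.\<close>

lemma path_crosses_frontier:
  assumes "p \<in> lattice_paths 0 v" "v \<notin> touched_vertices I"
  obtains q x y q' where "p = q @ x # y # q'" "x \<in> touched_vertices I"
    "{x, y} \<in> frontier_edges I" "q @ [x] \<in> lattice_paths 0 x"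
proof -
  have p: "successively adjacent p" "p \<noteq> []" "hd p = 0" "last p = v"
    using assms by (auto simp: lattice_paths_def)
  have "0 \<in> touched_vertices I" by (simp add: touched_vertices_def)
  then obtain q x y q' where q: "p = q @ x # y # q'" "x \<in> touched_vertices I" "y \<notin> touched_vertices I"
    using path_crossing[of p "touched_vertices I"] p assms by auto
  have "adjacent x y" "q @ [x] \<in> lattice_paths 0 x"
    using p q(1) by (auto simp: lattice_paths_def successively_append_iff hd_append split: if_splits)
  then have "{x, y} \<in> frontier_edges I" "q @ [x] \<in> lattice_paths 0 x"
    using q by (auto simp: frontier_edges_def touched_vertices_def)
  then show thesis using that q by blast
qed

text \<open>A path to the sphere of radius \<open>Suc n\<close> has to leave the touched set, which
  gives nonemptiness. Together the two facts make \<open>arg_min_on\<close> a genuine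
  minimiser.\<close>

lemma frontier_edges_finite_nonempty:
  fixes I :: "(int ^ 'd::finite) set set"
  assumes "I \<subseteq> ball_edges n"
  shows "finite (frontier_edges I)" "frontier_edges I \<noteq> {}"
proof -
  have sub: "touched_vertices I \<subseteq> graph_ball n"
    by (rule touched_vertices_subset_ball[OF assms])
  show "finite (frontier_edges I)"
    using frontier_edges_subset_ball[OF sub] finite_ball_edges by (rule finite_subset)
  obtain v :: "int ^ 'd" where "v \<in> graph_sphere (Suc n)" using graph_sphere_nonempty by blast
  then have v: "v \<notin> touched_vertices I" using sub by (auto simp: mem_graph_ball mem_graph_sphere)
  obtain p where "p \<in> lattice_paths 0 v" using lattice_paths_nonempty by blast
  then show "frontier_edges I \<noteq> {}" by (rule path_crosses_frontier[OF _ v]) auto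
qed

lemma ball_edges_mono: "m \<le> n \<Longrightarrow> ball_edges m \<subseteq> ball_edges n"
  by (auto simp: ball_edges_def mem_graph_ball subset_iff)

abbreviation next_edge :: "((int ^ 'd::finite) set \<Rightarrow> real) \<Rightarrow> nat \<Rightarrow> (int ^ 'd) set" where
  "next_edge w n \<equiv> arg_min_on w (frontier_edges (invaded_edges w n))"

abbreviation invaded_by :: "((int ^ 'd::finite) set \<Rightarrow> real) \<Rightarrow> nat \<Rightarrow> (int ^ 'd) set" where
  "invaded_by w n \<equiv> touched_vertices (invaded_edges w n)"

text \<open>Each step increases the radius by at most one. The bound carries its own induction: it
  makes the frontier finite, so that the next edge really belongs to it.\<close>

lemma invaded_edges_subset_ball: "invaded_edges w n \<subseteq> ball_edges n"
proof (induction n)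
  case (Suc n)
  have "next_edge w n \<in> frontier_edges (invaded_edges w n)"
    by (intro arg_min_if_finite frontier_edges_finite_nonempty[OF Suc])
  then have "next_edge w n \<in> ball_edges (Suc n)"
    using frontier_edges_subset_ball[OF touched_vertices_subset_ball[OF Suc]] by blast
  then show ?case using Suc ball_edges_mono[of n "Suc n"] by auto
qed simp

lemma invaded_by_subset_ball: "invaded_by w n \<subseteq> graph_ball n"
  by (intro touched_vertices_subset_ball invaded_edges_subset_ball)

lemma next_edge_in_frontier: "next_edge w n \<in> frontier_edges (invaded_edges w n)"
  by (intro arg_min_if_finite frontier_edges_finite_nonempty[OF invaded_edges_subset_ball])

lemma next_edge_less:
  assumes "inj_on w lattice_edges" "f \<in> frontier_edges (invaded_edges w n)" "f \<noteq> next_edge w n"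
  shows "w (next_edge w n) < w f"
proof -
  have "w (next_edge w n) \<le> w f"
    by (intro arg_min_least frontier_edges_finite_nonempty[OF invaded_edges_subset_ball] assms)
  moreover have "w (next_edge w n) \<noteq> w f"
    using assms next_edge_in_frontier[of w n] by (auto simp: inj_on_def frontier_edges_def)
  ultimately show ?thesis by simp
qed

lemma invaded_by_Suc: "invaded_by w (Suc n) = invaded_by w n \<union> next_edge w n"
  by (auto simp: touched_vertices_def)

lemma invaded_by_mono: "m \<le> n \<Longrightarrow> invaded_by w m \<subseteq> invaded_by w n"
  by (induction rule: dec_induct) (auto simp: invaded_by_Suc simp del: invaded_edges.simps)

text \<open>Frontier edges are not yet invaded, so every step adds a new edge. The exact count later
  forces the invasion out of every ball.\<close>

lemma card_invaded_edges: "finite (invaded_edges w n)" "card (invaded_edges w n) = n"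
proof (induction n)
  case (Suc n)
  show "finite (invaded_edges w (Suc n))" using Suc by simp
  show "card (invaded_edges w (Suc n)) = Suc n"
    using Suc next_edge_in_frontier[of w n] by (simp add: frontier_edges_def)
qed auto

text \<open>The next edge has an endpoint that is already invaded, so a step brings at most one new
  vertex; it brings none when both endpoints are invaded.\<close>

lemma next_edge_new_vertex:
  assumes "z \<in> invaded_by w (Suc n)" "z \<notin> invaded_by w n"
  obtains u where "next_edge w n = {z, u}" "adjacent z u" "u \<in> invaded_by w n"
    "invaded_by w (Suc n) = insert z (invaded_by w n)"
proof -
  have z: "z \<in> next_edge w n" using assms by (auto simp: invaded_by_Suc simp del: invaded_edges.simps)
  have e: "next_edge w n \<in> lattice_edges" "next_edge w n \<inter> invaded_by w n \<noteq> {}"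
    using next_edge_in_frontier[of w n] by (auto simp: frontier_edges_def)
  obtain u where u: "next_edge w n = {z, u}" "adjacent z u" by (rule lattice_edgeE[OF e(1) z])
  have "u \<in> invaded_by w n" using e u assms(2) by auto
  with u show thesis using that unfolding invaded_by_Suc by auto
qed

section \<open>The linking property of the most recently invaded vertex\<close>

text \<open>Stated through the linking property that the comparison uses, not through the time of
  invasion. A vertex acquires the property when it is invaded and keeps it until the next new vertex
  appears.\<close>

definition newest :: "((int ^ 'd::finite) set \<Rightarrow> real) \<Rightarrow> nat \<Rightarrow> int ^ 'd \<Rightarrow> bool" where
  "newest w n z \<longleftrightarrow> z \<in> invaded_by w n \<and>
     (\<forall>f\<in>frontier_edges (invaded_edges w n). \<forall>x\<in>f \<inter> invaded_by w n.
        (x, z) \<in> linked {e \<in> invaded_edges w n. w e < w f})"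

lemma newestD:
  assumes "newest w n z" "f \<in> frontier_edges (invaded_edges w n)" "x \<in> f" "x \<in> invaded_by w n"
  shows "(x, z) \<in> linked {e \<in> invaded_edges w n. w e < w f}"
  using assms by (auto simp: newest_def)

lemma frontier_edges_SucD:
  assumes "f \<in> frontier_edges (invaded_edges w (Suc n))" "x \<in> f" "x \<in> invaded_by w n"
  shows "f \<in> frontier_edges (invaded_edges w n)" "f \<noteq> next_edge w n"
  using assms by (auto simp: frontier_edges_def)

text \<open>With no new vertex, each remaining frontier edge was on the frontier before, and the set
  of invaded edges only grows, so the old links persist.\<close>

lemma newest_Suc_old:
  assumes "newest w n z" "invaded_by w (Suc n) = invaded_by w n"
  shows "newest w (Suc n) z"
  unfolding newest_def
proof (intro conjI ballI)
  show "z \<in> invaded_by w (Suc n)" using assms by (simp only: newest_def)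
next
  fix f x assume f: "f \<in> frontier_edges (invaded_edges w (Suc n))" and x: "x \<in> f \<inter> invaded_by w (Suc n)"
  then have x': "x \<in> f" "x \<in> invaded_by w n" using assms(2) by auto
  have "(x, z) \<in> linked {e \<in> invaded_edges w n. w e < w f}"
    using newestD[OF assms(1) frontier_edges_SucD(1)[OF f x'] x'] .
  then show "(x, z) \<in> linked {e \<in> invaded_edges w (Suc n). w e < w f}"
    by (rule set_mp[OF linked_mono, rotated]) auto
qed

text \<open>A frontier edge at an old vertex \<open>x\<close> is heavier than the new edge \<open>{z, u}\<close>, and both
  edges lie on the previous frontier, so \<open>x\<close> and \<open>u\<close> are both linked to the previous newest vertex.\<close>

lemma newest_Suc_new:
  assumes inj: "inj_on w lattice_edges" and "newest w n z0"
    and z: "z \<in> invaded_by w (Suc n)" "z \<notin> invaded_by w n"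
  shows "newest w (Suc n) z"
  unfolding newest_def
proof (intro conjI ballI)
  show "z \<in> invaded_by w (Suc n)" by fact
next
  fix f x assume f: "f \<in> frontier_edges (invaded_edges w (Suc n))" and x: "x \<in> f \<inter> invaded_by w (Suc n)"
  obtain u where u: "next_edge w n = {z, u}" "adjacent z u" "u \<in> invaded_by w n"
    "invaded_by w (Suc n) = insert z (invaded_by w n)"
    by (rule next_edge_new_vertex[OF z])
  show "(x, z) \<in> linked {e \<in> invaded_edges w (Suc n). w e < w f}" (is "_ \<in> linked ?A")
  proof (cases "x = z")
    case False
    then have x': "x \<in> f" "x \<in> invaded_by w n" using x u by auto
    note f' = frontier_edges_SucD[OF f x']
    have less: "w (next_edge w n) < w f" by (rule next_edge_less[OF inj f'])
    have "(x, z0) \<in> linked {e \<in> invaded_edges w n. w e < w f}"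
      by (rule newestD[OF assms(2) f'(1) x'])
    then have 1: "(x, z0) \<in> linked ?A"
      by (rule set_mp[OF linked_mono, rotated]) auto
    have "(u, z0) \<in> linked {e \<in> invaded_edges w n. w e < w (next_edge w n)}"
      by (rule newestD[OF assms(2) next_edge_in_frontier]) (use u in auto)
    then have 2: "(u, z0) \<in> linked ?A"
      by (rule set_mp[OF linked_mono, rotated]) (use less in auto)
    have "{u, z} = next_edge w n" using u by auto
    then have "(u, z) \<in> linked ?A"
      using less by (intro linked_edge) simp
    then show ?thesis by (rule linked_trans[OF linked_trans[OF 1 linked_sym[OF 2]]])
  qed simp
qed

lemma newest_0: "newest w 0 0"
  by (auto simp: newest_def touched_vertices_def)

lemma ex_newest:
  assumes "inj_on w lattice_edges"
  shows "\<exists>z. newest w n z"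
proof (induction n)
  case 0
  then show ?case using newest_0 by blast
next
  case (Suc n)
  then obtain z0 where z0: "newest w n z0" by blast
  show ?case
  proof (cases "invaded_by w (Suc n) = invaded_by w n")
    case True
    then show ?thesis using newest_Suc_old[OF z0] by blast
  next
    case False
    then obtain z where "z \<in> invaded_by w (Suc n)" "z \<notin> invaded_by w n"
      using invaded_by_mono[of n "Suc n" w] by auto
    then show ?thesis using newest_Suc_new[OF assms z0] by blast
  qed
qed

text \<open>The witness \<open>m\<close> is the step at which \<open>z\<close> first
  appears.\<close>

lemma invaded_imp_newest:
  assumes "inj_on w lattice_edges" "z \<in> invaded_by w n"
  shows "\<exists>m\<le>n. newest w m z"
  using assms(2)
proof (induction n)
  case 0
  then show ?case using newest_0 by (auto simp: touched_vertices_def)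
next
  case (Suc n)
  show ?case
  proof (cases "z \<in> invaded_by w n")
    case True
    then show ?thesis using Suc.IH le_SucI by blast
  next
    case False
    then show ?thesis
      using ex_newest[OF assms(1), of n] newest_Suc_new[OF assms(1) _ Suc.prems False] by blast
  qed
qed

text \<open>Take the first step that leaves the ball of radius \<open>R - 1\<close>. It adds a
  single vertex, adjacent to that ball, which therefore lies on the sphere while all other invaded
  vertices are still inside.\<close>

lemma invasion_reaches_sphere:
  assumes "R \<ge> 1"
  obtains n z where "z \<in> graph_sphere R" "z \<in> invaded_by w (Suc n)" "z \<notin> invaded_by w n"
    "invaded_by w (Suc n) \<subseteq> graph_ball R"
proof -
  let ?P = "\<lambda>n. \<not> invaded_by w n \<subseteq> graph_ball (R - 1)"
  have "\<exists>n. ?P n"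
  proof (rule ccontr)
    assume "\<not> (\<exists>n. ?P n)"
    then have "e \<in> ball_edges (R - 1)" if "e \<in> invaded_edges w n" for e n
      using that invaded_edges_subset_ball[of w n]
      by (fastforce simp: ball_edges_def touched_vertices_def)
    then have "invaded_edges w n \<subseteq> ball_edges (R - 1)" for n by blast
    \<comment> \<open>One step more than the ball has edges is already impossible.\<close>
    from card_mono[OF finite_ball_edges this] show False
      using card_invaded_edges(2)[of w "Suc (card (ball_edges (R - 1) :: (int ^ 'a) set set))"]
      by (metis Suc_n_not_le_n)
  qed
  then have n: "?P (LEAST n. ?P n)" and least: "\<And>m. m < (LEAST n. ?P n) \<Longrightarrow> \<not> ?P m"
    by (rule LeastI_ex, blast dest: not_less_Least)
  have "\<not> ?P 0" by (auto simp: touched_vertices_def mem_graph_ball)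
  then obtain n where Suc_n: "(LEAST n. ?P n) = Suc n" using n by (metis not0_implies_Suc)
  have sub: "invaded_by w n \<subseteq> graph_ball (R - 1)" using least[of n] Suc_n by simp
  obtain z where z: "z \<in> invaded_by w (Suc n)" "z \<notin> graph_ball (R - 1)"
    using n unfolding Suc_n by blast
  then have z': "z \<notin> invaded_by w n" using sub by blast
  obtain u where u: "next_edge w n = {z, u}" "adjacent z u" "u \<in> invaded_by w n"
    "invaded_by w (Suc n) = insert z (invaded_by w n)"
    by (rule next_edge_new_vertex[OF z(1) z'])
  have "l1_norm u \<le> R - 1" using u sub by (auto simp: mem_graph_ball)
  then have "l1_norm z = R"
    using z(2) l1_norm_adjacent_le[of u z] u(2) adjacent_sym[of z u] assms by (auto simp: mem_graph_ball)
  then have "z \<in> graph_sphere R" "invaded_by w (Suc n) \<subseteq> graph_ball R"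
    using u(4) sub by (auto simp: mem_graph_ball mem_graph_sphere)
  then show thesis using that z z' by blast
qed

subsection \<open>Comparison of passage times\<close>

lemma path_time_nonneg: "path_time K w p \<ge> 0"
  by (auto simp: path_time_def intro!: sum_list_nonneg)

lemma path_time_append:
  "path_time K w (p @ x # q) = path_time K w (p @ [x]) + path_time K w (x # q)"
  by (simp only: path_time_def path_edges_append[of p x q] map_append sum_list_append)

lemma passage_time_le: "p \<in> lattice_paths x y \<Longrightarrow> passage_time K w x y \<le> path_time K w p"
  unfolding passage_time_def
  by (rule cINF_lower) (auto intro!: bdd_belowI[of _ 0] path_time_nonneg)

lemma exit_time_le: "z \<in> graph_sphere R \<Longrightarrow> exit_time K w R \<le> passage_time K w 0 z"
  unfolding exit_time_def by (intro Min_le) (auto simp: finite_graph_sphere)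

lemma exit_time_attained: "\<exists>z\<in>graph_sphere R. exit_time K w R = passage_time K w 0 z"
proof -
  have "exit_time K w R \<in> passage_time K w 0 ` graph_sphere R"
    unfolding exit_time_def using graph_sphere_nonempty finite_graph_sphere by (intro Min_in) auto
  then show ?thesis by auto
qed

text \<open>The deterministic form in which the gaps between weights enter the comparison: one edge
  costs at least as much as \<open>num_edges\<close> copies of any lighter edge.\<close>

definition dominated :: "real \<Rightarrow> nat \<Rightarrow> ((int ^ 'd::finite) set \<Rightarrow> real) \<Rightarrow> bool" where
  "dominated K R w \<longleftrightarrow> (\<forall>e\<in>ball_edges R. \<forall>f\<in>ball_edges R.
     w e < w f \<longrightarrow> real (num_edges TYPE('d) R) * exp (K * w e) \<le> exp (K * w f))"

text \<open>The link to \<open>z\<close> replaces the edge \<open>f\<close>. It uses fewer than N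
  edges, where N is \<open>num_edges\<close>, each costing at most a fraction 1/N of
  \<open>f\<close>, so the detour saves at least that fraction. The explicit saving is what survives
  as a strict inequality when infima are taken.\<close>

lemma passage_time_linked_le:
  fixes w :: "(int ^ 'd::finite) set \<Rightarrow> real"
  assumes dom: "dominated K R w" and R: "R \<ge> 1"
    and f: "f \<in> ball_edges R" and A: "A \<subseteq> ball_edges R"
    and p: "q @ [x] \<in> lattice_paths 0 x"
    and link: "(x, z) \<in> linked {e \<in> A. w e < w f}"
  shows "passage_time K w 0 z + exp (K * w f) / num_edges TYPE('d) R
    \<le> path_time K w (q @ [x]) + exp (K * w f)"
proof -
  let ?A = "{e \<in> A. w e < w f}" and ?N = "num_edges TYPE('d) R"
  have N: "?N \<ge> 2" using card_ball_edges_ge_2[OF R] by (simp add: num_edges_def)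
  have A_lattice: "?A \<subseteq> lattice_edges" using A by (auto simp: ball_edges_def)
  have finA: "finite ?A" using finite_subset[OF A finite_ball_edges] by simp
  \<comment> \<open>The edge \<open>f\<close> is not lighter than itself; excluding it yields
    \<open>?N - 1\<close> and hence the saving.\<close>
  have "?A \<subseteq> ball_edges R - {f}" using A by auto
  from card_mono[OF _ this] have cardA: "card ?A \<le> ?N - 1"
    using f finite_ball_edges[of R] by (simp add: num_edges_def)
  obtain s where s: "s \<in> lattice_paths x z" "distinct s" "set (path_edges s) \<subseteq> ?A"
    by (rule linked_imp_distinct_path[OF link A_lattice])
  have "path_time K w s = (\<Sum>e\<in>set (path_edges s). exp (K * w e))"
    unfolding path_time_def using distinct_path_edges[OF s(2)] by (rule sum_list_distinct_conv_sum_set)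
  also have "\<dots> \<le> (\<Sum>e\<in>?A. exp (K * w e))"
    by (rule sum_mono2[OF finA s(3)]) simp
  also have "\<dots> \<le> (\<Sum>e\<in>?A. exp (K * w f) / ?N)"
  proof (rule sum_mono)
    fix e assume "e \<in> ?A"
    then have "?N * exp (K * w e) \<le> exp (K * w f)" using dom f A by (auto simp: dominated_def)
    then show "exp (K * w e) \<le> exp (K * w f) / ?N" using N by (simp add: field_simps)
  qed
  also have "\<dots> = card ?A * (exp (K * w f) / ?N)" by simp
  also have "\<dots> \<le> (?N - 1) * (exp (K * w f) / ?N)"
    using cardA by (intro mult_right_mono) auto
  also have "\<dots> = exp (K * w f) - exp (K * w f) / ?N"
    using N by (simp add: field_simps of_nat_diff)
  finally have time_s: "path_time K w s \<le> exp (K * w f) - exp (K * w f) / ?N" .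
  obtain s' where s': "s = x # s'" using s(1) by (cases s) (auto simp: lattice_paths_def)
  have "q @ x # s' \<in> lattice_paths 0 z"
    using lattice_paths_append[OF p] s(1) s' by simp
  from passage_time_le[OF this, of K w] show ?thesis
    using time_s path_time_append[of K w q x s'] s' by simp
qed

lemma path_time_crossing:
  "path_time K w (q @ x # y # q') \<ge> path_time K w (q @ [x]) + exp (K * w {x, y})"
  using path_time_nonneg[of K w "y # q'"] path_time_append[of K w q x "y # q'"]
  by (simp add: path_time_def)

text \<open>A path beating the exit time but ending at a vertex that is never invaded would be
  rerouted to \<open>z\<close> on the sphere at no greater cost, a contradiction.\<close>

lemma IP_contains_FPP_if_dominated:
  fixes w :: "(int ^ 'd::finite) set \<Rightarrow> real"
  assumes inj: "inj_on w lattice_edges" and dom: "dominated K R w" and R: "R \<ge> 1"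
  shows "IP_contains_FPP K R V w"
  unfolding IP_contains_FPP_def
proof (intro ballI impI, rule ccontr)
  fix v assume v: "passage_time K w 0 v < exit_time K w R" "\<not> invaded w v"
  obtain n z where z: "z \<in> graph_sphere R" "z \<in> invaded_by w (Suc n)" "z \<notin> invaded_by w n"
    and sub: "invaded_by w (Suc n) \<subseteq> graph_ball R"
    by (rule invasion_reaches_sphere[OF R])
  obtain z0 where "newest w n z0" using ex_newest[OF inj] by blast
  from newest_Suc_new[OF inj this z(2,3)] have newest: "newest w (Suc n) z" .
  obtain p where p: "p \<in> lattice_paths 0 v" "path_time K w p < exit_time K w R"
    using v(1) lattice_paths_nonempty unfolding passage_time_def
    by (subst (asm) cINF_less_iff) (auto intro!: bdd_belowI[of _ 0] path_time_nonneg)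
  have "v \<notin> invaded_by w (Suc n)" using v(2) unfolding invaded_def by blast
  then obtain q x y q' where q: "p = q @ x # y # q'" "x \<in> invaded_by w (Suc n)"
    "{x, y} \<in> frontier_edges (invaded_edges w (Suc n))" "q @ [x] \<in> lattice_paths 0 x"
    by (rule path_crosses_frontier[OF p(1)])
  have time_p: "path_time K w (q @ [x]) + exp (K * w {x, y}) \<le> path_time K w p"
    unfolding q(1) by (rule path_time_crossing)
  have adj: "adjacent x y" using q(3) by (auto simp: frontier_edges_def)
  show False
  proof (cases "x \<in> graph_sphere R")
    \<comment> \<open>The edge \<open>{x, y}\<close> may leave the ball here, so no detour is
      available; but the prefix up to \<open>x\<close> alone already takes the exit time.\<close>
    case True
    have "exit_time K w R \<le> path_time K w (q @ [x])"
      using exit_time_le[OF True] passage_time_le[OF q(4)] by (rule order_trans)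
    then show False using time_p p(2) exp_gt_zero[of "K * w {x, y}"] by linarith
  next
    case False
    moreover have "x \<in> graph_ball R" using q(2) sub by blast
    ultimately have xy: "{x, y} \<in> ball_edges R"
      using adj l1_norm_adjacent_le[OF adj]
      by (auto simp: ball_edges_def mem_graph_ball mem_graph_sphere)
    \<comment> \<open>The number of steps may far exceed \<open>R\<close>. The radius comes from
      \<open>sub\<close>, since both endpoints of an invaded edge are invaded.\<close>
    have "invaded_edges w (Suc n) \<subseteq> ball_edges R"
      using invaded_edges_subset_ball[of w "Suc n"] sub
      by (fastforce simp: ball_edges_def touched_vertices_def simp del: invaded_edges.simps)
    from passage_time_linked_le[OF dom R xy this q(4) newestD[OF newest q(3) _ q(2)]]
    have "passage_time K w 0 z + exp (K * w {x, y}) / num_edges TYPE('d) R \<le> path_time K w p"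
      using time_p by simp
    moreover have "exp (K * w {x, y}) / num_edges TYPE('d) R \<ge> 0" by simp
    ultimately show False using exit_time_le[OF z(1), of K w] p(2) by linarith
  qed
qed

text \<open>During the first \<open>n\<close> steps the sphere is not reached, so every path to a
  fastest exit point \<open>z\<close> crosses the frontier of the step \<open>m\<close> at which
  \<open>v\<close> is newest, and can be rerouted to \<open>v\<close>.\<close>

lemma FPP_contains_IP_if_dominated:
  fixes w :: "(int ^ 'd::finite) set \<Rightarrow> real"
  assumes inj: "inj_on w lattice_edges" and dom: "dominated K R w" and "n < R"
    and V: "\<And>v. v \<in> V \<Longrightarrow> invaded w v \<Longrightarrow> v \<in> invaded_by w n"
  shows "FPP_contains_IP K R V w"
  unfolding FPP_contains_IP_def
proof (intro ballI impI)
  fix v assume v: "v \<in> V" "invaded w v"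
  have R: "R \<ge> 1" using \<open>n < R\<close> by simp
  obtain m where m: "m \<le> n" "newest w m v"
    using invaded_imp_newest[OF inj V[OF v]] by blast
  let ?N = "num_edges TYPE('d) R"
  \<comment> \<open>The least saving over all edges of the ball: a positive bound independent of the
    path, so the inequality stays strict after the infimum.\<close>
  define c where "c = Min ((\<lambda>f. exp (K * w f) / ?N) ` ball_edges R)"
  have N: "?N \<ge> 2" using card_ball_edges_ge_2[OF R] by (simp add: num_edges_def)
  then have "(ball_edges R :: (int ^ 'd) set set) \<noteq> {}" by (auto simp: num_edges_def)
  then have "c > 0" unfolding c_def using N by (subst Min_gr_iff) (auto simp: finite_ball_edges)
  obtain z where z: "z \<in> graph_sphere R" "exit_time K w R = passage_time K w 0 z"
    using exit_time_attained by blast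
  have sub: "invaded_by w m \<subseteq> graph_ball m" by (rule invaded_by_subset_ball)
  have z_out: "z \<notin> invaded_by w m"
    using sub z(1) m(1) \<open>n < R\<close> by (auto simp: mem_graph_ball mem_graph_sphere)
  have "passage_time K w 0 v + c \<le> path_time K w p" if p: "p \<in> lattice_paths 0 z" for p
  proof -
    obtain q x y q' where q: "p = q @ x # y # q'" "x \<in> invaded_by w m"
      "{x, y} \<in> frontier_edges (invaded_edges w m)" "q @ [x] \<in> lattice_paths 0 x"
      by (rule path_crosses_frontier[OF p z_out])
    have "Suc m \<le> R" using m(1) \<open>n < R\<close> by simp
    then have xy: "{x, y} \<in> ball_edges R"
      using q(3) frontier_edges_subset_ball[OF sub] ball_edges_mono[of "Suc m" R] by blast
    have "m \<le> R" using \<open>Suc m \<le> R\<close> by simp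
    then have "invaded_edges w m \<subseteq> ball_edges R"
      using invaded_edges_subset_ball[of w m] ball_edges_mono[of m R] by blast
    from passage_time_linked_le[OF dom R xy this q(4) newestD[OF m(2) q(3) _ q(2)]]
    have "passage_time K w 0 v + exp (K * w {x, y}) / ?N \<le> path_time K w p"
      using path_time_crossing[of K w q x y q'] q(1) by simp
    moreover have "c \<le> exp (K * w {x, y}) / ?N"
      unfolding c_def using xy by (intro Min_le) (auto simp: finite_ball_edges)
    ultimately show ?thesis by linarith
  qed
  then have "passage_time K w 0 v + c \<le> passage_time K w 0 z"
    unfolding passage_time_def[of K w 0 z] by (intro cINF_greatest lattice_paths_nonempty)
  then show "passage_time K w 0 v < exit_time K w R" using \<open>c > 0\<close> z(2) by simp
qed

subsection \<open>Measurability\<close>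

abbreviation uniform01 :: "real measure" where
  "uniform01 \<equiv> uniform_measure lborel {0..1}"

lemma prob_space_uniform01: "prob_space uniform01"
  by (rule prob_space_uniform_measure) auto

lemma prob_space_weight_measure: "prob_space weight_measure"
  unfolding weight_measure_def by (intro prob_space_PiM prob_space_uniform01)

lemma countable_lattice_edges: "countable lattice_edges"
proof -
  have "lattice_edges = (\<lambda>(x, y). {x, y}) ` {(x, y). adjacent x y}"
    by (auto simp: lattice_edges_def)
  then show ?thesis by (metis countableI_type countable_image)
qed

lemma measurable_weight [measurable]:
  "e \<in> lattice_edges \<Longrightarrow> (\<lambda>w. w e) \<in> borel_measurable weight_measure"
  unfolding weight_measure_def
  using measurable_component_singleton[of e lattice_edges "\<lambda>_. uniform01"]
  by (simp cong: measurable_cong_sets)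

lemma pred_weight_compare:
  assumes "e \<in> lattice_edges" "f \<in> lattice_edges"
  shows "Measurable.pred weight_measure (\<lambda>w. w e \<le> w f + c)"
    and "Measurable.pred weight_measure (\<lambda>w. w e = w f)"
  unfolding Measurable.pred_def
  by (intro borel_measurable_le borel_measurable_eq borel_measurable_add
      borel_measurable_const measurable_weight assms)+

lemma pred_inj_on_weights [measurable]:
  "Measurable.pred weight_measure (\<lambda>w. inj_on w lattice_edges)"
proof -
  have *: "Measurable.pred weight_measure (\<lambda>w. w e = w f \<longrightarrow> e = f)"
    if "e \<in> lattice_edges" "f \<in> lattice_edges" for e f :: "(int ^ 'a) set"
    using pred_weight_compare(2)[OF that] by measurable
  show ?thesis
    unfolding inj_on_def Measurable.pred_def
    by (intro sets.sets_Collect_countable_All' countable_lattice_edges *[unfolded Measurable.pred_def])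
qed

text \<open>With ties \<open>arg_min_on\<close> is an unspecified choice among minimisers.
  Injectivity makes it expressible by comparisons of weights, which are measurable.\<close>

lemma arg_min_on_eq_iff:
  fixes w :: "(int ^ 'd::finite) set \<Rightarrow> real"
  assumes "inj_on w lattice_edges" "S \<subseteq> lattice_edges" "finite S" "S \<noteq> {}"
  shows "arg_min_on w S = a \<longleftrightarrow> a \<in> S \<and> (\<forall>b\<in>S. w a \<le> w b)"
proof
  assume "arg_min_on w S = a"
  then show "a \<in> S \<and> (\<forall>b\<in>S. w a \<le> w b)"
    using arg_min_if_finite(1)[OF assms(3,4), of w] arg_min_least[OF assms(3,4), of _ w] by blast
next
  assume a: "a \<in> S \<and> (\<forall>b\<in>S. w a \<le> w b)"
  have m: "arg_min_on w S \<in> S" by (rule arg_min_if_finite(1)[OF assms(3,4)])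
  then have "w a = w (arg_min_on w S)"
    using a arg_min_least[OF assms(3,4), of a w] by (simp add: antisym)
  then show "arg_min_on w S = a" using a m assms(1,2) by (metis inj_onD subsetD)
qed

text \<open>The state after \<open>n\<close> steps ranges over the finitely many subsets of
  \<open>ball_edges n\<close>, and each transition is a finite combination of weight comparisons.
  Injectivity is part of the event because it determines the minimiser.\<close>

lemma pred_invaded_edges_eq:
  fixes F :: "(int ^ 'd::finite) set set"
  shows "Measurable.pred weight_measure (\<lambda>w. inj_on w lattice_edges \<and> invaded_edges w n = F)"
proof (induction n arbitrary: F)
  case (Suc n)
  let ?C = "{G :: (int ^ 'd) set set. G \<subseteq> ball_edges n}"
  have C: "finite ?C"
    using finite_ball_edges by auto
  have eq: "(inj_on w lattice_edges \<and> invaded_edges w (Suc n) = F) \<longleftrightarrow>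
     (\<exists>G\<in>?C. (inj_on w lattice_edges \<and> invaded_edges w n = G) \<and>
        (\<exists>a\<in>frontier_edges G. (\<forall>b\<in>frontier_edges G. w a \<le> w b) \<and> insert a G = F))"
    for w :: "(int ^ 'd) set \<Rightarrow> real"
  proof (cases "inj_on w lattice_edges")
    case True
    have "frontier_edges (invaded_edges w n) \<subseteq> lattice_edges"
      by (auto simp: frontier_edges_def)
    note iff = arg_min_on_eq_iff[OF True this frontier_edges_finite_nonempty[OF invaded_edges_subset_ball]]
    show ?thesis using True invaded_edges_subset_ball[of w n] iff by auto
  qed simp
  have fin: "finite (frontier_edges G)" if "G \<in> ?C" for G :: "(int ^ 'd) set set"
    using that frontier_edges_finite_nonempty(1) by auto
  have lat: "a \<in> lattice_edges" if "a \<in> frontier_edges G" for a and G :: "(int ^ 'd) set set"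
    using that by (simp add: frontier_edges_def)
  have le: "Measurable.pred weight_measure (\<lambda>w. w a \<le> w b)"
    if "a \<in> frontier_edges G" "b \<in> frontier_edges G" for a b and G :: "(int ^ 'd) set set"
    using pred_weight_compare(1)[OF lat[OF that(1)] lat[OF that(2)], of 0] by simp
  show ?case
    unfolding eq
    by (intro pred_intros_finite pred_intros_logic C fin Suc le) auto
qed simp

text \<open>Finitely many values are possible after \<open>n\<close> steps, so the event is a finite
  union of those treated above.\<close>

lemma pred_invaded_by:
  fixes Q :: "(int ^ 'd::finite) set set \<Rightarrow> bool"
  shows "Measurable.pred weight_measure (\<lambda>w. inj_on w lattice_edges \<and> Q (invaded_edges w n))"
proof -
  let ?C = "{G :: (int ^ 'd) set set. G \<subseteq> ball_edges n \<and> Q G}"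
  have C: "finite ?C"
    by (rule finite_subset[of _ "Pow (ball_edges n)"]) (auto simp: finite_ball_edges)
  have eq: "(inj_on w lattice_edges \<and> Q (invaded_edges w n)) \<longleftrightarrow>
     (\<exists>G\<in>?C. inj_on w lattice_edges \<and> invaded_edges w n = G)" for w :: "(int ^ 'd) set \<Rightarrow> real"
    using invaded_edges_subset_ball[of w n] by auto
  show ?thesis unfolding eq by (intro pred_intros_finite C pred_invaded_edges_eq)
qed

lemma pred_invaded:
  "Measurable.pred weight_measure (\<lambda>w. inj_on w lattice_edges \<and> invaded w v)"
proof -
  have "Measurable.pred weight_measure
      (\<lambda>w. \<exists>n. inj_on w lattice_edges \<and> v \<in> invaded_by w n)"
    by (intro pred_intros_countable pred_invaded_by)
  then show ?thesis by (simp add: invaded_def)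
qed


text \<open>Paths are lists over a countable type, so this is a countable infimum of finite
  sums.\<close>

lemma measurable_passage_time [measurable]:
  "(\<lambda>w. passage_time K w x y) \<in> borel_measurable weight_measure"
proof -
  have path: "(\<lambda>w. \<Sum>e\<leftarrow>es. exp (K * w e)) \<in> borel_measurable weight_measure"
    if "set es \<subseteq> lattice_edges" for es :: "(int ^ 'd::finite) set list"
    using that
  proof (induction es)
    case (Cons e es)
    then have [measurable]: "(\<lambda>w. w e) \<in> borel_measurable weight_measure"
      "(\<lambda>w. \<Sum>e\<leftarrow>es. exp (K * w e)) \<in> borel_measurable weight_measure"
      by (auto intro: measurable_weight)
    show ?case by simp
  qed simp
  show ?thesis
    unfolding passage_time_def path_time_def
  proof (intro borel_measurable_cINF_real path)
    fix p assume "p \<in> lattice_paths x y"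
    then show "set (path_edges p) \<subseteq> lattice_edges"
      by (intro path_edges_subset_lattice_edges) (auto simp: lattice_paths_def)
  qed simp
qed

lemma less_exit_time_iff:
  "t < exit_time K w R \<longleftrightarrow> (\<forall>z\<in>graph_sphere R. t < passage_time K w 0 z)"
  unfolding exit_time_def using finite_graph_sphere graph_sphere_nonempty
  by (subst Min_gr_iff) auto

lemma pred_less_exit_time [measurable]:
  "Measurable.pred weight_measure (\<lambda>w. passage_time K w 0 v < exit_time K w R)"
  unfolding less_exit_time_iff
  by (intro pred_intros_countable_bounded) measurable

lemma pred_IP_contains_FPP [measurable]:
  "Measurable.pred weight_measure (\<lambda>w. inj_on w lattice_edges \<and> IP_contains_FPP K R V w)"
proof -
  \<comment> \<open>Injectivity is repeated inside the implication because
    \<open>pred_invaded\<close> covers only the conjunction; the outer conjunct makes the two forms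
    equivalent.\<close>
  have "Measurable.pred weight_measure (\<lambda>w. inj_on w lattice_edges \<and>
     (\<forall>v\<in>V. passage_time K w 0 v < exit_time K w R \<longrightarrow> inj_on w lattice_edges \<and> invaded w v))"
    by (intro pred_intros_logic(3) pred_inj_on_weights pred_intros_countable_bounded
        pred_intros_logic(4)[OF pred_less_exit_time pred_invaded])
  then show ?thesis by (rule measurable_cong[THEN iffD1, rotated]) (auto simp: IP_contains_FPP_def)
qed

lemma pred_FPP_contains_IP [measurable]:
  "Measurable.pred weight_measure (\<lambda>w. inj_on w lattice_edges \<and> FPP_contains_IP K R V w)"
proof -
  have "Measurable.pred weight_measure (\<lambda>w. inj_on w lattice_edges \<and>
     (\<forall>v\<in>V. inj_on w lattice_edges \<and> invaded w v \<longrightarrow> passage_time K w 0 v < exit_time K w R))"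
    by (intro pred_intros_logic(3) pred_inj_on_weights pred_intros_countable_bounded
        pred_intros_logic(4)[OF pred_invaded pred_less_exit_time])
  then show ?thesis by (rule measurable_cong[THEN iffD1, rotated]) (auto simp: FPP_contains_IP_def)
qed

subsection \<open>Gaps between the weights\<close>

text \<open>Independence of two distinct coordinates, stated as a joint law. It is checked on
  rectangles, whose preimages are cylinders over \<open>{i, j}\<close>.\<close>

lemma distr_PiM_pair:
  assumes M: "\<And>i. i \<in> I \<Longrightarrow> prob_space (M i)" and ij: "i \<in> I" "j \<in> I" "i \<noteq> j"
  shows "distr (PiM I M) (M i \<Otimes>\<^sub>M M j) (\<lambda>x. (x i, x j)) = M i \<Otimes>\<^sub>M M j"
proof (rule sym, rule pair_measure_eqI)
  show "sigma_finite_measure (M i)" "sigma_finite_measure (M j)"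
    using M ij by (auto intro: prob_space_imp_sigma_finite)
next
  fix A B assume AB: "A \<in> sets (M i)" "B \<in> sets (M j)"
  define C where "C k = (if k = i then A else B)" for k
  have C: "C k \<in> sets (M k)" if "k \<in> {i, j}" for k
    using that AB by (auto simp: C_def)
  have meas: "(\<lambda>x. (x i, x j)) \<in> PiM I M \<rightarrow>\<^sub>M M i \<Otimes>\<^sub>M M j"
    using ij by (intro measurable_Pair measurable_component_singleton)
  have "(\<lambda>x. (x i, x j)) -` (A \<times> B) \<inter> space (PiM I M) = prod_emb I M {i, j} (Pi\<^sub>E {i, j} C)"
    using ij by (auto simp: prod_emb_def space_PiM C_def PiE_iff)
  then have "emeasure (distr (PiM I M) (M i \<Otimes>\<^sub>M M j) (\<lambda>x. (x i, x j))) (A \<times> B)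
      = emeasure (PiM I M) (prod_emb I M {i, j} (Pi\<^sub>E {i, j} C))"
    using AB by (simp add: emeasure_distr[OF meas])
  also have "\<dots> = (\<Prod>k\<in>{i, j}. emeasure (M k) (C k))"
    using ij C by (intro emeasure_PiM_emb M) auto
  finally show "emeasure (M i) A * emeasure (M j) B =
      emeasure (distr (PiM I M) (M i \<Otimes>\<^sub>M M j) (\<lambda>x. (x i, x j))) (A \<times> B)"
    using ij by (simp add: C_def)
qed simp

lemma emeasure_uniform01_interval:
  assumes "\<delta> \<ge> 0"
  shows "emeasure uniform01 {x..x + \<delta>} \<le> ennreal \<delta>"
proof -
  have "emeasure uniform01 {x..x + \<delta>} = emeasure lborel ({0..1} \<inter> {x..x + \<delta>})"
    by (simp add: divide_ennreal_def)
  also have "\<dots> \<le> emeasure lborel {x..x + \<delta>}" by (intro emeasure_mono) auto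
  finally show ?thesis using assms by simp
qed

text \<open>By Fubini on the joint law: for a fixed value of \<open>w e\<close>, the uniform weight
  \<open>w f\<close> hits an interval of length \<delta> with probability at most \<delta>.\<close>

lemma prob_weight_in_interval_le:
  assumes e: "e \<in> lattice_edges" and f: "f \<in> lattice_edges" and "e \<noteq> f" and \<delta>: "\<delta> \<ge> 0"
  shows "measure weight_measure {w \<in> space weight_measure. w f \<in> {w e..w e + \<delta>}} \<le> \<delta>"
proof -
  interpret U: prob_space uniform01 by (rule prob_space_uniform01)
  interpret W: prob_space "weight_measure :: ((int ^ 'a) set \<Rightarrow> real) measure"
    by (rule prob_space_weight_measure)
  let ?W = "weight_measure :: ((int ^ 'a) set \<Rightarrow> real) measure"
  let ?S = "{p \<in> space (uniform01 \<Otimes>\<^sub>M uniform01). snd p \<in> {fst p..fst p + \<delta>}}"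
  have S: "?S \<in> sets (uniform01 \<Otimes>\<^sub>M uniform01)"
  proof -
    have "{p \<in> space (borel \<Otimes>\<^sub>M borel). snd p \<in> {fst p..fst p + \<delta>}} \<in> sets (borel \<Otimes>\<^sub>M borel)"
      unfolding atLeastAtMost_iff by measurable
    moreover have "sets (uniform01 \<Otimes>\<^sub>M uniform01) = sets (borel \<Otimes>\<^sub>M borel :: (real \<times> real) measure)"
      by (intro sets_pair_measure_cong) auto
    ultimately show ?thesis by (simp add: space_pair_measure)
  qed
  have meas: "(\<lambda>w. (w e, w f)) \<in> ?W \<rightarrow>\<^sub>M uniform01 \<Otimes>\<^sub>M uniform01"
    unfolding weight_measure_def using e f
    by (intro measurable_Pair measurable_component_singleton)
  have "emeasure ?W {w \<in> space ?W. w f \<in> {w e..w e + \<delta>}}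
      = emeasure ?W ((\<lambda>w. (w e, w f)) -` ?S \<inter> space ?W)"
    by (intro arg_cong2[where f = emeasure]) (auto simp: space_pair_measure)
  also have "\<dots> = emeasure (distr ?W (uniform01 \<Otimes>\<^sub>M uniform01) (\<lambda>w. (w e, w f))) ?S"
    by (rule emeasure_distr[OF meas S, symmetric])
  also have "\<dots> = emeasure (uniform01 \<Otimes>\<^sub>M uniform01) ?S"
    using distr_PiM_pair[of lattice_edges "\<lambda>_. uniform01" e f, OF prob_space_uniform01 e f \<open>e \<noteq> f\<close>]
    by (simp only: weight_measure_def)
  also have "\<dots> = (\<integral>\<^sup>+x. emeasure uniform01 (Pair x -` ?S) \<partial>uniform01)"
    by (rule U.emeasure_pair_measure_alt[OF S])
  also have "\<dots> \<le> (\<integral>\<^sup>+x. ennreal \<delta> \<partial>uniform01)"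
  proof (rule nn_integral_mono)
    fix x :: real
    have "Pair x -` ?S = {x..x + \<delta>}" by (auto simp: space_pair_measure)
    then show "emeasure uniform01 (Pair x -` ?S) \<le> ennreal \<delta>"
      using emeasure_uniform01_interval[OF \<delta>, of x] by (simp only:)
  qed
  also have "\<dots> = ennreal \<delta>" by (simp add: U.emeasure_space_1[simplified])
  finally show ?thesis using \<delta> by (simp add: W.emeasure_eq_measure)
qed

text \<open>The pair estimate with \<delta> = 0 excludes each tie almost surely, and there are only
  countably many pairs of edges.\<close>

lemma AE_inj_on_weights: "AE w in weight_measure. inj_on w lattice_edges"
proof -
  interpret W: prob_space "weight_measure :: ((int ^ 'a) set \<Rightarrow> real) measure"
    by (rule prob_space_weight_measure)
  have "AE w in weight_measure. w e = w f \<longrightarrow> e = f"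
    if ef: "e \<in> lattice_edges" "f \<in> lattice_edges" for e f :: "(int ^ 'a) set"
  proof (cases "e = f")
    case False
    have "measure weight_measure {w \<in> space weight_measure. w f \<in> {w e..w e + 0}} = 0"
      using prob_weight_in_interval_le[OF ef False, of 0] by (simp add: antisym)
    moreover have "{w \<in> space weight_measure. w f \<in> {w e..w e + 0}} = {w \<in> space weight_measure. w e = w f}"
      by auto
    ultimately have "measure weight_measure {w \<in> space weight_measure. w e = w f} = 0"
      by simp
    then have "{w \<in> space weight_measure. w e = w f} \<in> null_sets weight_measure"
      using pred_weight_compare(2)[OF ef]
      by (simp add: null_sets_def W.emeasure_eq_measure Measurable.pred_def)
    then show ?thesis
      by (rule AE_I') auto
  qed simp
  then show ?thesis
    unfolding inj_on_def by (simp add: AE_ball_countable countable_lattice_edges)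
qed

text \<open>One-sided closed intervals, taken over both orders of each pair: for \<delta> \<ge> 0
  this says that any two weights in the ball differ by more than \<delta>.\<close>

definition gapped :: "real \<Rightarrow> nat \<Rightarrow> ((int ^ 'd::finite) set \<Rightarrow> real) \<Rightarrow> bool" where
  "gapped \<delta> R w \<longleftrightarrow> (\<forall>e\<in>ball_edges R. \<forall>f\<in>ball_edges R. e \<noteq> f \<longrightarrow> w f \<notin> {w e..w e + \<delta>})"

lemma pred_gapped [measurable]: "Measurable.pred weight_measure (gapped \<delta> R)"
proof -
  have "Measurable.pred weight_measure (\<lambda>w. e \<noteq> f \<longrightarrow> w f \<notin> {w e..w e + \<delta>})"
    if "e \<in> ball_edges R" "f \<in> ball_edges R" for e f :: "(int ^ 'a) set"
  proof -
    have "e \<in> lattice_edges" "f \<in> lattice_edges" using that by (auto simp: ball_edges_def)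
    from pred_weight_compare(1)[OF this, of 0] pred_weight_compare(1)[OF this(2,1), of \<delta>]
    show ?thesis unfolding atLeastAtMost_iff by simp
  qed
  then show ?thesis
    unfolding gapped_def by (intro pred_intros_finite finite_ball_edges)
qed

lemma prob_not_gapped_le:
  fixes R :: nat
  assumes \<delta>: "\<delta> \<ge> 0" and N: "N = card (ball_edges R :: (int ^ 'd::finite) set set)"
  shows "measure weight_measure {w \<in> space weight_measure. \<not> gapped \<delta> R (w :: (int ^ 'd) set \<Rightarrow> real)}
    \<le> real N * (real N - 1) * \<delta>"
proof -
  interpret W: prob_space "weight_measure :: ((int ^ 'd) set \<Rightarrow> real) measure"
    by (rule prob_space_weight_measure)
  let ?W = "weight_measure :: ((int ^ 'd) set \<Rightarrow> real) measure"
  let ?E = "ball_edges R :: (int ^ 'd) set set"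
  let ?P = "SIGMA e:?E. ?E - {e}"
  let ?B = "\<lambda>(e, f). {w \<in> space ?W. w f \<in> {w e..w e + \<delta>}}"
  have finP: "finite ?P" using finite_ball_edges by auto
  have cardP: "real (card ?P) = real N * (real N - 1)"
  proof (cases "N = 0")
    case True
    then have "?E = {}" using finite_ball_edges by (metis N card_0_eq)
    then show ?thesis using True by simp
  next
    case False
    have "card ?P = (\<Sum>e\<in>?E. card (?E - {e}))"
      using finite_ball_edges by (intro card_SigmaI) auto
    also have "\<dots> = N * (N - 1)" using finite_ball_edges by (simp add: N)
    finally show ?thesis using False by (simp add: of_nat_diff)
  qed
  have lat: "e \<in> lattice_edges" if "e \<in> ?E" for e using that by (simp add: ball_edges_def)
  have sets: "?B p \<in> sets ?W" if "p \<in> ?P" for p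
  proof -
    obtain e f where p: "p = (e, f)" by fastforce
    have "e \<in> lattice_edges" "f \<in> lattice_edges" using that lat by (auto simp: p)
    from pred_weight_compare(1)[OF this, of 0] pred_weight_compare(1)[OF this(2,1), of \<delta>]
    have "Measurable.pred ?W (\<lambda>w. w f \<in> {w e..w e + \<delta>})"
      unfolding atLeastAtMost_iff by simp
    then show ?thesis unfolding p prod.case by (simp only: Measurable.pred_def)
  qed
  have "{w \<in> space ?W. \<not> gapped \<delta> R w} = (\<Union>p\<in>?P. ?B p)"
    by (auto simp: gapped_def)
  moreover have "?B ` ?P \<subseteq> sets ?W" using sets by (rule image_subsetI)
  ultimately have "measure ?W {w \<in> space ?W. \<not> gapped \<delta> R w} \<le> (\<Sum>p\<in>?P. measure ?W (?B p))"
    using W.finite_measure_subadditive_finite[OF finP, of ?B] by (simp only:)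
  also have "\<dots> \<le> (\<Sum>p\<in>?P. \<delta>)"
  proof (rule sum_mono)
    fix p assume "p \<in> ?P"
    then obtain e f where p: "p = (e, f)" "e \<in> ?E" "f \<in> ?E" "e \<noteq> f" by auto
    show "measure ?W (?B p) \<le> \<delta>"
      unfolding p prod.case using p lat \<delta> by (intro prob_weight_in_interval_le)
  qed
  also have "\<dots> = real N * (real N - 1) * \<delta>" using cardP by simp
  finally show ?thesis .
qed

subsection \<open>The parameters\<close>

context
  fixes R :: nat and t :: real and N :: nat
  assumes R: "R \<ge> 1" and t: "0 < t" "t < 1"
  defines "N \<equiv> num_edges TYPE('d::finite) R"
begin

lemma num_edges_ge_2: "N \<ge> 2"
  using card_ball_edges_ge_2[OF R] by (simp add: N_def num_edges_def)

text \<open>The lower bound is Bernoulli's inequality for the N-th power of 1 - t/N and serves to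
  bound \<open>K_param\<close>. The upper bound is 1 + s \<le> exp s at s = ln (1 - t) / N and
  serves the union bound.\<close>

lemma one_minus_powr_bounds:
  "t / N \<le> 1 - (1 - t) powr (1 / N)" "1 - (1 - t) powr (1 / N) \<le> - ln (1 - t) / N"
proof -
  have N: "real N \<ge> 2" using num_edges_ge_2 by simp
  have tN: "0 < 1 - t / N" using t N by (simp add: field_simps)
  have "1 + real N * (- (t / N)) \<le> (1 + - (t / N)) ^ N"
    using tN by (intro Bernoulli_inequality) simp
  then have "1 - t \<le> (1 - t / N) powr N" using N tN by (simp add: powr_realpow)
  then have "(1 - t) powr (1 / N) \<le> ((1 - t / N) powr N) powr (1 / N)"
    using t N by (intro powr_mono2) auto
  also have "\<dots> = 1 - t / N" using N tN by (simp add: powr_powr)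
  finally show "t / N \<le> 1 - (1 - t) powr (1 / N)" by simp
  have "(1 - t) powr (1 / N) = exp (ln (1 - t) / N)" using t by (simp add: powr_def)
  then show "1 - (1 - t) powr (1 / N) \<le> - ln (1 - t) / N"
    using exp_ge_add_one_self[of "ln (1 - t) / N"] by linarith
qed

lemma one_minus_powr_pos: "0 < 1 - (1 - t) powr (1 / N)"
proof -
  have "0 < t / N" using t num_edges_ge_2 by simp
  then show ?thesis using one_minus_powr_bounds(1) by linarith
qed

lemma delta_pos: "delta TYPE('d) R t > 0"
  unfolding delta_def N_def[symmetric]
  using one_minus_powr_pos num_edges_ge_2 by (intro divide_pos_pos) auto

lemma delta_le: "real N * (real N - 1) * delta TYPE('d) R t \<le> - ln (1 - t)"
proof -
  have "real N * (real N - 1) * delta TYPE('d) R t = real N * (1 - (1 - t) powr (1 / N))"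
    unfolding delta_def N_def[symmetric] using num_edges_ge_2 by simp
  also have "\<dots> \<le> real N * (- ln (1 - t) / N)"
    using one_minus_powr_bounds(2) by (intro mult_left_mono) auto
  also have "\<dots> = - ln (1 - t)" using num_edges_ge_2 by simp
  finally show ?thesis .
qed

lemma K_param_le: "K_param TYPE('d) R t \<le> (real N)\<^sup>2 * ln N / t"
proof -
  have N: "real N \<ge> 2" using num_edges_ge_2 by simp
  have "K_param TYPE('d) R t = ln N * (real N - 1) / (1 - (1 - t) powr (1 / N))"
    unfolding K_param_def delta_def N_def[symmetric] by simp
  also have "\<dots> \<le> ln N * (real N - 1) / (t / N)"
    using one_minus_powr_bounds(1) one_minus_powr_pos t N
    by (intro divide_left_mono mult_nonneg_nonneg mult_pos_pos) auto
  also have "\<dots> = (ln N * N / t) * (real N - 1)" by simp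
  also have "\<dots> \<le> (ln N * N / t) * real N"
    using t N by (intro mult_left_mono) auto
  finally show ?thesis by (simp add: power2_eq_square mult_ac)
qed

text \<open>Raising a weight by \<open>delta\<close> multiplies the passage time of its edge by
  exactly N, by the choice of \<open>K_param\<close>.\<close>

lemma gapped_imp_dominated:
  fixes w :: "(int ^ 'd) set \<Rightarrow> real"
  assumes "gapped (delta TYPE('d) R t) R w"
  shows "dominated (K_param TYPE('d) R t) R w"
  unfolding dominated_def N_def[symmetric]
proof (intro ballI impI)
  let ?K = "K_param TYPE('d) R t" and ?\<delta> = "delta TYPE('d) R t"
  fix e f :: "(int ^ 'd) set"
  assume ef: "e \<in> ball_edges R" "f \<in> ball_edges R" "w e < w f"
  then have le: "w e + ?\<delta> \<le> w f" using assms by (fastforce simp: gapped_def)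
  have N: "real N \<ge> 2" using num_edges_ge_2 by simp
  have K: "?K * ?\<delta> = ln N" "?K \<ge> 0"
    using delta_pos N by (simp_all add: K_param_def N_def[symmetric])
  have "real N * exp (?K * w e) = exp (?K * (w e + ?\<delta>))"
    using K N by (simp add: distrib_left exp_add)
  also have "\<dots> \<le> exp (?K * w f)" using le K by (simp add: mult_left_mono)
  finally show "real N * exp (?K * w e) \<le> exp (?K * w f)" .
qed

text \<open>Injectivity holds almost surely, so adding it to the good event does not change the
  failure probability.\<close>

lemma prob_not_dominated_le:
  "measure weight_measure {w \<in> space weight_measure.
     \<not> (inj_on (w :: (int ^ 'd) set \<Rightarrow> real) lattice_edges \<and> gapped (delta TYPE('d) R t) R w)}
   \<le> - ln (1 - t)"
proof -
  interpret W: prob_space "weight_measure :: ((int ^ 'd) set \<Rightarrow> real) measure"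
    by (rule prob_space_weight_measure)
  let ?W = "weight_measure :: ((int ^ 'd) set \<Rightarrow> real) measure"
  let ?\<delta> = "delta TYPE('d) R t"
  have "measure ?W {w \<in> space ?W. \<not> (inj_on w lattice_edges \<and> gapped ?\<delta> R w)}
      = measure ?W {w \<in> space ?W. \<not> gapped ?\<delta> R w}"
    using AE_inj_on_weights by (intro W.finite_measure_eq_AE) (auto elim!: AE_mp)
  also have "\<dots> \<le> real N * (real N - 1) * ?\<delta>"
    using delta_pos by (intro prob_not_gapped_le) (auto simp: N_def num_edges_def)
  also have "\<dots> \<le> - ln (1 - t)" by (rule delta_le)
  finally show ?thesis .
qed

end

text \<open>The union bound loses - ln (1 - t) instead of t; taking t = \<epsilon> / 2 absorbs the
  difference. Strictness leaves room for the further error in the second containment.\<close>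

lemma minus_ln_one_minus_less:
  fixes t :: real
  assumes "0 < t" "t < 1 / 2"
  shows "- ln (1 - t) < 2 * t"
proof -
  have "- ln (1 - t) \<le> t + 2 * t\<^sup>2" using ln_one_minus_pos_lower_bound[of t] assms by simp
  also have "\<dots> < 2 * t" using assms by (simp add: power2_eq_square)
  finally show ?thesis .
qed

section \<open>Probabilities of the two containments\<close>

lemma prob_IP_contains_FPP:
  assumes R: "R \<ge> 1" and t: "0 < t" "t < 1"
  shows "measure weight_measure {w \<in> space weight_measure. inj_on w lattice_edges \<and>
     IP_contains_FPP (K_param TYPE('d::finite) R t) R (V :: (int ^ 'd) set) w} \<ge> 1 + ln (1 - t)"
proof -
  interpret W: prob_space "weight_measure :: ((int ^ 'd) set \<Rightarrow> real) measure"
    by (rule prob_space_weight_measure)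
  let ?W = "weight_measure :: ((int ^ 'd) set \<Rightarrow> real) measure"
  let ?G = "\<lambda>w. inj_on w lattice_edges \<and> gapped (delta TYPE('d) R t) R w"
  have "1 + ln (1 - t) \<le> 1 - measure ?W {w \<in> space ?W. \<not> ?G w}"
    using prob_not_dominated_le[OF R t, where 'd = 'd] by simp
  also have "\<dots> = measure ?W {w \<in> space ?W. ?G w}"
    by (subst W.prob_neg) auto
  also have "\<dots> \<le> measure ?W {w \<in> space ?W. inj_on w lattice_edges \<and>
      IP_contains_FPP (K_param TYPE('d) R t) R V w}"
    using R t by (intro W.finite_measure_mono)
      (auto intro!: IP_contains_FPP_if_dominated gapped_imp_dominated simp: Measurable.pred_def[symmetric])
  finally show ?thesis .
qed

text \<open>For a finite \<open>V\<close>, each configuration has a step by which all vertices of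
  \<open>V\<close> that are ever invaded have been invaded. The events thus increase to an almost
  sure one, and continuity from below gives the limit without a rate.\<close>

lemma prob_invaded_by_tendsto_1:
  assumes "finite V"
  shows "(\<lambda>n. measure weight_measure {w \<in> space weight_measure. inj_on w lattice_edges \<and>
     (\<forall>v\<in>V. invaded w (v :: int ^ 'd::finite) \<longrightarrow> v \<in> invaded_by w n)}) \<longlonglongrightarrow> 1"
proof -
  interpret W: prob_space "weight_measure :: ((int ^ 'd) set \<Rightarrow> real) measure"
    by (rule prob_space_weight_measure)
  let ?W = "weight_measure :: ((int ^ 'd) set \<Rightarrow> real) measure"
  let ?A = "\<lambda>n. {w \<in> space ?W. inj_on w lattice_edges \<and> (\<forall>v\<in>V. invaded w v \<longrightarrow> v \<in> invaded_by w n)}"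
  have sets: "?A n \<in> sets ?W" for n
  proof -
    have "Measurable.pred ?W (\<lambda>w. inj_on w lattice_edges \<and>
        (\<forall>v\<in>V. (inj_on w lattice_edges \<and> invaded w v) \<longrightarrow> (inj_on w lattice_edges \<and> v \<in> invaded_by w n)))"
      by (intro pred_intros_logic(3) pred_inj_on_weights pred_intros_countable_bounded
          pred_intros_logic(4)[OF pred_invaded pred_invaded_by])
    moreover have "?A n = {w \<in> space ?W. inj_on w lattice_edges \<and>
        (\<forall>v\<in>V. (inj_on w lattice_edges \<and> invaded w v) \<longrightarrow> (inj_on w lattice_edges \<and> v \<in> invaded_by w n))}"
      by auto
    ultimately show ?thesis by (simp only: Measurable.pred_def)
  qed
  have "incseq ?A"
    by (intro incseq_SucI Collect_mono) (simp add: invaded_by_Suc del: invaded_edges.simps)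
  then have "(\<lambda>n. measure ?W (?A n)) \<longlonglongrightarrow> measure ?W (\<Union>n. ?A n)"
    using sets by (intro W.finite_Lim_measure_incseq) auto
  moreover have "(\<Union>n. ?A n) = {w \<in> space ?W. inj_on w lattice_edges}"
  proof (intro equalityI subsetI)
    fix w assume w: "w \<in> {w \<in> space ?W. inj_on w lattice_edges}"
    have "\<forall>v\<in>V. \<exists>n. invaded w v \<longrightarrow> v \<in> invaded_by w n" by (auto simp: invaded_def)
    then obtain N where N: "\<forall>v\<in>V. invaded w v \<longrightarrow> v \<in> invaded_by w (N v)" by metis
    obtain n where n: "\<forall>v\<in>V. N v \<le> n"
      using finite_nat_set_iff_bounded_le[of "N ` V"] assms by auto
    have "v \<in> invaded_by w n" if "v \<in> V" "invaded w v" for v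
      using that N n invaded_by_mono[of "N v" n w] by auto
    then have "w \<in> ?A n" using w by simp
    then show "w \<in> (\<Union>n. ?A n)" by blast
  qed auto
  moreover have "measure ?W {w \<in> space ?W. inj_on w lattice_edges} = 1"
    using AE_inj_on_weights by (subst W.prob_Collect_eq_1) auto
  ultimately show ?thesis by simp
qed

text \<open>On the good event for the gaps, early invasion of \<open>V\<close> implies the
  containment, so at most the failure probability of the gaps is lost.\<close>

lemma prob_FPP_contains_IP:
  assumes n: "n < R" and t: "0 < t" "t < 1"
  shows "measure weight_measure {w \<in> space weight_measure. inj_on w lattice_edges \<and>
     FPP_contains_IP (K_param TYPE('d::finite) R t) R (V :: (int ^ 'd) set) w} \<ge>
     measure weight_measure {w \<in> space weight_measure. inj_on w lattice_edges \<and>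
       (\<forall>v\<in>V. invaded w v \<longrightarrow> v \<in> invaded_by w n)} + ln (1 - t)"
proof -
  interpret W: prob_space "weight_measure :: ((int ^ 'd) set \<Rightarrow> real) measure"
    by (rule prob_space_weight_measure)
  let ?W = "weight_measure :: ((int ^ 'd) set \<Rightarrow> real) measure"
  let ?G = "\<lambda>w. inj_on w lattice_edges \<and> gapped (delta TYPE('d) R t) R w"
  let ?H = "\<lambda>w. inj_on w lattice_edges \<and> (\<forall>v\<in>V. invaded w v \<longrightarrow> v \<in> invaded_by w n)"
  let ?F = "\<lambda>w. inj_on w lattice_edges \<and> FPP_contains_IP (K_param TYPE('d) R t) R V w"
  have R: "R \<ge> 1" using n by simp
  have F: "{w \<in> space ?W. ?F w} \<in> sets ?W" "{w \<in> space ?W. \<not> ?G w} \<in> sets ?W"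
    by (simp_all add: Measurable.pred_def[symmetric]) measurable
  have "{w \<in> space ?W. ?H w} \<subseteq> {w \<in> space ?W. ?F w} \<union> {w \<in> space ?W. \<not> ?G w}"
    using n R t by (auto intro!: FPP_contains_IP_if_dominated gapped_imp_dominated)
  then have "measure ?W {w \<in> space ?W. ?H w}
      \<le> measure ?W ({w \<in> space ?W. ?F w} \<union> {w \<in> space ?W. \<not> ?G w})"
    using F by (intro W.finite_measure_mono) auto
  also have "\<dots> \<le> measure ?W {w \<in> space ?W. ?F w} + measure ?W {w \<in> space ?W. \<not> ?G w}"
    using F by (intro measure_Un_le)
  finally show ?thesis using prob_not_dominated_le[OF R t, where 'd = 'd] by simp
qed

text \<open>The power of 3 comes from 2R + 1 \<le> 3R, the factor 12 from ln (3R) \<le> 3 ln R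
  (valid for R \<ge> 2), from the exponent \<open>2 * CARD('d)\<close> in the edge count and from
  the division by \<epsilon> / 2.\<close>

lemma K_param_bigo:
  assumes R: "R \<ge> 2" and \<epsilon>: "0 < \<epsilon>" "\<epsilon> \<le> 1"
  shows "K_param TYPE('d::finite) R (\<epsilon> / 2)
    \<le> (12 * CARD('d) * 3 ^ (4 * CARD('d))) * (1 / \<epsilon>) * real R ^ (4 * CARD('d)) * ln R"
proof -
  let ?N = "num_edges TYPE('d) R" and ?d = "CARD('d)"
  have N2: "real ?N \<ge> 2" using card_ball_edges_ge_2[of R, where 'd = 'd] R by (simp add: num_edges_def)
  have "?N \<le> (2 * R + 1) ^ (2 * ?d)"
    unfolding num_edges_def by (rule card_ball_edges_le)
  also have "\<dots> \<le> (3 * R) ^ (2 * ?d)" using R by (intro power_mono) auto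
  finally have N: "real ?N \<le> (3 * real R) ^ (2 * ?d)"
    by (metis of_nat_le_iff of_nat_mult of_nat_numeral of_nat_power)
  have "(real ?N)\<^sup>2 \<le> ((3 * real R) ^ (2 * ?d))\<^sup>2" using N by (intro power_mono) auto
  also have "\<dots> = 3 ^ (4 * ?d) * real R ^ (4 * ?d)"
    by (simp add: power_mult[symmetric] power_mult_distrib mult.commute)
  finally have sq: "(real ?N)\<^sup>2 \<le> 3 ^ (4 * ?d) * real R ^ (4 * ?d)" .
  have "ln (real ?N) \<le> ln ((3 * real R) ^ (2 * ?d))" using N N2 R by (subst ln_le_cancel_iff) auto
  also have "\<dots> = 2 * ?d * ln (3 * real R)" using R by (subst ln_realpow) auto
  also have "\<dots> \<le> 2 * ?d * (3 * ln R)"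
  proof (rule mult_left_mono)
    have "4 \<le> R * R" using mult_le_mono[OF R R] by simp
    then have "3 * R \<le> R ^ 3" by (simp add: power3_eq_cube)
    then have "3 * real R \<le> real R ^ 3"
      by (metis of_nat_le_iff of_nat_mult of_nat_numeral of_nat_power)
    then have "ln (3 * real R) \<le> ln (real R ^ 3)" using R by (subst ln_le_cancel_iff) auto
    then show "ln (3 * real R) \<le> 3 * ln R" using R by (simp add: ln_realpow)
  qed simp
  finally have ln: "ln (real ?N) \<le> 6 * ?d * ln R" by simp
  have "K_param TYPE('d) R (\<epsilon> / 2) \<le> (real ?N)\<^sup>2 * ln ?N / (\<epsilon> / 2)"
    using R \<epsilon> by (intro K_param_le) auto
  also have "\<dots> \<le> (3 ^ (4 * ?d) * real R ^ (4 * ?d)) * (6 * ?d * ln R) / (\<epsilon> / 2)"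
    using sq ln N2 \<epsilon> by (intro divide_right_mono mult_mono) auto
  also have "\<dots> = (12 * ?d * 3 ^ (4 * ?d)) * (1 / \<epsilon>) * real R ^ (4 * ?d) * ln R"
    by (simp add: field_simps)
  finally show ?thesis .
qed

text \<open>Conjoining injectivity restricts to configurations with distinct weights and makes both
  events measurable, so \<open>\<P>\<close> is not the default value 0 of a nonmeasurable
  set.\<close>

theorem theorem3p1:
  shows "(\<forall>\<epsilon>::real. \<forall>r::nat. 0 < \<epsilon> \<and> \<epsilon> \<le> 2 \<longrightarrow>
           (\<exists>R0\<ge>1. \<forall>R\<ge>R0.
              \<P>(w in (weight_measure :: ((int ^ 'd::finite) set \<Rightarrow> real) measure).
                 inj_on w lattice_edges \<and>
                 IP_contains_FPP (K_param TYPE('d) R (\<epsilon> / 2)) R (graph_ball R) w) \<ge> 1 - \<epsilon> \<and>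
              \<P>(w in (weight_measure :: ((int ^ 'd) set \<Rightarrow> real) measure).
                 inj_on w lattice_edges \<and>
                 FPP_contains_IP (K_param TYPE('d) R (\<epsilon> / 2)) R (graph_ball r) w) \<ge> 1 - \<epsilon>))
       \<and> (\<exists>C>0. \<exists>R1>0. \<exists>\<epsilon>1>0. \<forall>R::nat. \<forall>\<epsilon>::real. R \<ge> R1 \<and> 0 < \<epsilon> \<and> \<epsilon> \<le> \<epsilon>1 \<longrightarrow>
            K_param TYPE('d) R (\<epsilon> / 2) \<le> C * (1 / \<epsilon>) * real R ^ (4 * CARD('d)) * ln (real R))"
proof (intro conjI allI impI)
  fix \<epsilon> :: real and r :: nat
  assume \<epsilon>: "0 < \<epsilon> \<and> \<epsilon> \<le> 2"
  let ?W = "weight_measure :: ((int ^ 'd) set \<Rightarrow> real) measure"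
  let ?I = "\<lambda>R. \<P>(w in ?W. inj_on w lattice_edges \<and>
    IP_contains_FPP (K_param TYPE('d) R (\<epsilon> / 2)) R (graph_ball R) w)"
  let ?F = "\<lambda>R. \<P>(w in ?W. inj_on w lattice_edges \<and>
    FPP_contains_IP (K_param TYPE('d) R (\<epsilon> / 2)) R (graph_ball r) w)"
  show "\<exists>R0\<ge>1. \<forall>R\<ge>R0. ?I R \<ge> 1 - \<epsilon> \<and> ?F R \<ge> 1 - \<epsilon>"
  \<comment> \<open>For \<epsilon> \<ge> 1 the bounds hold because probabilities are nonnegative;
    otherwise \<epsilon> / 2 < 1/2, as the logarithmic estimate requires.\<close>
  proof (cases "\<epsilon> < 1")
    case False
    then have "1 - \<epsilon> \<le> measure ?W A" for A using measure_nonneg[of ?W A] by linarith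
    then show ?thesis by blast
  next
    case True
    define t where "t = \<epsilon> / 2"
    have t: "0 < t" "t < 1 / 2" using \<epsilon> True by (simp_all add: t_def)
    have ln: "- ln (1 - t) < \<epsilon>" using minus_ln_one_minus_less[OF t] by (simp add: t_def)
    let ?H = "\<lambda>n. measure ?W {w \<in> space ?W. inj_on w lattice_edges \<and>
      (\<forall>v\<in>graph_ball r. invaded w v \<longrightarrow> v \<in> invaded_by w n)}"
    have "1 - \<epsilon> - ln (1 - t) < 1" using ln by simp
    then have "eventually (\<lambda>n. 1 - \<epsilon> - ln (1 - t) < ?H n) sequentially"
      by (rule order_tendstoD(1)[OF prob_invaded_by_tendsto_1[OF card_graph_ball_le(1)]])
    then obtain n where n: "1 - \<epsilon> - ln (1 - t) < ?H n"
      by (auto simp: eventually_sequentially)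
    show ?thesis
    \<comment> \<open>The number \<open>n\<close> depends only on \<epsilon> and \<open>r\<close>;
      \<open>Suc n\<close> guarantees \<open>n < R\<close>, so that the first \<open>n\<close> steps
      stay strictly inside the sphere.\<close>
    proof (intro exI[of _ "Suc n"] conjI allI impI)
      fix R assume R: "R \<ge> Suc n"
      show "?I R \<ge> 1 - \<epsilon>"
        using prob_IP_contains_FPP[of R t "graph_ball R :: (int ^ 'd) set"] R t ln
        by (simp add: t_def)
      show "?F R \<ge> 1 - \<epsilon>"
        using prob_FPP_contains_IP[of n R t "graph_ball r :: (int ^ 'd) set"] R t n
        by (simp add: t_def)
    qed simp
  qed
next
  show "\<exists>C>0. \<exists>R1>0. \<exists>\<epsilon>1>0. \<forall>R::nat. \<forall>\<epsilon>::real. R \<ge> R1 \<and> 0 < \<epsilon> \<and> \<epsilon> \<le> \<epsilon>1 \<longrightarrow>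
      K_param TYPE('d) R (\<epsilon> / 2) \<le> C * (1 / \<epsilon>) * real R ^ (4 * CARD('d)) * ln (real R)"
  proof (intro exI conjI allI impI)
    fix R :: nat and \<epsilon> :: real
    assume "2 \<le> R \<and> 0 < \<epsilon> \<and> \<epsilon> \<le> 1"
    then show "K_param TYPE('d) R (\<epsilon> / 2)
        \<le> (12 * CARD('d) * 3 ^ (4 * CARD('d))) * (1 / \<epsilon>) * real R ^ (4 * CARD('d)) * ln (real R)"
      using K_param_bigo by blast
  qed auto
qed

end
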